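(* Let $H$ be a finite-dimensional pointed Hopf algebra over a field $\Bbbk$. For every right $H$-simple left $H$-comodule algebra $A$ with $A^{\mathrm{co}H}=\Bbbk$, one has $\dim A<\infty$ and $\dim A$ divides $\dim H$.
   Context: Everything is over a field $\Bbbk$. A Hopf algebra is pointed if each of its simple subcoalgebras is one-dimensional. A left $H$-comodule algebra is an algebra $A$ that is a left $H$-comodule whose coaction $\rho\colon A\to H\otimes A$ is an algebra map. $A$ is right $H$-simple if $A\neq0$ and its only right ideals that are $H$-subcomodules are $0$ and $A$. $A^{\mathrm{co}H}=\{a\in A\mid \rho(a)=1\otimes a\}$; $A^{\mathrm{co}H}=\Bbbk$ means it equals $\Bbbk 1_A$. *)

theory Defs
  imports Complex_Main "HOL-Library.Poly_Mapping"
begin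

section \<open>Free vector spaces and tensor products over a field\<close>

text \<open>
  The free vector space on the elements of a type \<open>'x\<close> is \<open>'x \<Rightarrow>\<^sub>0 'k\<close>, with basis the
  elements \<open>pure x\<close>.  (The convolution product that the library puts on this type
  is not used.)
\<close>

definition free_scale :: "'k::field \<Rightarrow> ('x \<Rightarrow>\<^sub>0 'k) \<Rightarrow> ('x \<Rightarrow>\<^sub>0 'k)"
  where "free_scale c p = Poly_Mapping.map ((*) c) p"

definition pure :: "'x \<Rightarrow> ('x \<Rightarrow>\<^sub>0 'k::field)"
  where "pure x = Poly_Mapping.single x 1"

text \<open>The linear extension of \<open>f\<close> from basis elements to the free vector space.\<close>

definition free_lift ::
  "('k::field \<Rightarrow> 'u::ab_group_add \<Rightarrow> 'u) \<Rightarrow> ('x \<Rightarrow> 'u) \<Rightarrow> ('x \<Rightarrow>\<^sub>0 'k) \<Rightarrow> 'u"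
  where "free_lift s f p = (\<Sum>x\<in>Poly_Mapping.keys p. s (Poly_Mapping.lookup p x) (f x))"

abbreviation free_bind :: "('x \<Rightarrow>\<^sub>0 'k::field) \<Rightarrow> ('x \<Rightarrow> ('y \<Rightarrow>\<^sub>0 'k)) \<Rightarrow> ('y \<Rightarrow>\<^sub>0 'k)"
  where "free_bind p f \<equiv> free_lift free_scale f p"

text \<open>
  \<open>V \<otimes> W\<close> is the free vector space on \<open>V \<times> W\<close> modulo \<open>tensor_null\<close>, the span of the
  bilinearity relations; \<open>v \<otimes> w\<close> is the class of \<open>pure (v, w)\<close>.  The tensor product
  depends on the scalar multiplications and so is not a type of its own.  Its elements
  are therefore given by representatives, and equality in \<open>V \<otimes> W\<close> is \<open>tensor_eq\<close>.
  Likewise \<open>U \<otimes> V \<otimes> W\<close> is the free vector space on triples modulo the trilinearity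
  relations.
\<close>

definition tensor_null ::
  "('k::field \<Rightarrow> 'v::ab_group_add \<Rightarrow> 'v) \<Rightarrow> ('k \<Rightarrow> 'w::ab_group_add \<Rightarrow> 'w) \<Rightarrow> ('v \<times> 'w \<Rightarrow>\<^sub>0 'k) set"
  where "tensor_null sV sW = module.span free_scale
    ({pure (v + v', w) - pure (v, w) - pure (v', w) | v v' w. True} \<union>
     {pure (v, w + w') - pure (v, w) - pure (v, w') | v w w'. True} \<union>
     {pure (sV c v, w) - free_scale c (pure (v, w)) | c v w. True} \<union>
     {pure (v, sW c w) - free_scale c (pure (v, w)) | c v w. True})"

definition tensor_eq ::
  "('k::field \<Rightarrow> 'v::ab_group_add \<Rightarrow> 'v) \<Rightarrow> ('k \<Rightarrow> 'w::ab_group_add \<Rightarrow> 'w) \<Rightarrow>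
    ('v \<times> 'w \<Rightarrow>\<^sub>0 'k) \<Rightarrow> ('v \<times> 'w \<Rightarrow>\<^sub>0 'k) \<Rightarrow> bool"
  where "tensor_eq sV sW p q \<longleftrightarrow> p - q \<in> tensor_null sV sW"

definition tensor3_null ::
  "('k::field \<Rightarrow> 'u::ab_group_add \<Rightarrow> 'u) \<Rightarrow> ('k \<Rightarrow> 'v::ab_group_add \<Rightarrow> 'v) \<Rightarrow>
    ('k \<Rightarrow> 'w::ab_group_add \<Rightarrow> 'w) \<Rightarrow> ('u \<times> 'v \<times> 'w \<Rightarrow>\<^sub>0 'k) set"
  where "tensor3_null sU sV sW = module.span free_scale
    ({pure (u + u', v, w) - pure (u, v, w) - pure (u', v, w) | u u' v w. True} \<union>
     {pure (u, v + v', w) - pure (u, v, w) - pure (u, v', w) | u v v' w. True} \<union>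
     {pure (u, v, w + w') - pure (u, v, w) - pure (u, v, w') | u v w w'. True} \<union>
     {pure (sU c u, v, w) - free_scale c (pure (u, v, w)) | c u v w. True} \<union>
     {pure (u, sV c v, w) - free_scale c (pure (u, v, w)) | c u v w. True} \<union>
     {pure (u, v, sW c w) - free_scale c (pure (u, v, w)) | c u v w. True})"

definition tensor3_eq ::
  "('k::field \<Rightarrow> 'u::ab_group_add \<Rightarrow> 'u) \<Rightarrow> ('k \<Rightarrow> 'v::ab_group_add \<Rightarrow> 'v) \<Rightarrow>
    ('k \<Rightarrow> 'w::ab_group_add \<Rightarrow> 'w) \<Rightarrow>
    ('u \<times> 'v \<times> 'w \<Rightarrow>\<^sub>0 'k) \<Rightarrow> ('u \<times> 'v \<times> 'w \<Rightarrow>\<^sub>0 'k) \<Rightarrow> bool"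
  where "tensor3_eq sU sV sW p q \<longleftrightarrow> p - q \<in> tensor3_null sU sV sW"

lemma lookup_free_scale[simp]: "Poly_Mapping.lookup (free_scale c p) x = c * Poly_Mapping.lookup p x"
  unfolding free_scale_def by transfer (auto simp: when_def)

lemma vector_space_free_scale: "vector_space free_scale"
  by standard (auto intro!: poly_mapping_eqI simp: lookup_add algebra_simps)

context vector_space begin
lemma free_lift_alt: "finite S \<Longrightarrow> Poly_Mapping.keys p \<subseteq> S \<Longrightarrow> free_lift scale f p = (\<Sum>x\<in>S. scale (Poly_Mapping.lookup p x) (f x))"
  unfolding free_lift_def by (rule sum.mono_neutral_left) (auto simp: in_keys_iff)

lemma free_lift_pure[simp]: "free_lift scale f (pure x) = f x"
  by (simp add: free_lift_def pure_def)

lemma free_lift_add: "free_lift scale f (p + q) = free_lift scale f p + free_lift scale f q"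
proof -
  let ?S = "Poly_Mapping.keys p \<union> Poly_Mapping.keys q"
  have "Poly_Mapping.keys (p+q) \<subseteq> ?S" by (rule keys_add)
  then show ?thesis by (simp add: free_lift_alt[of ?S] lookup_add scale_left_distrib sum.distrib)
qed
lemma free_lift_scale: "free_lift scale f (free_scale c p) = scale c (free_lift scale f p)"
proof -
  have "Poly_Mapping.keys (free_scale c p) \<subseteq> Poly_Mapping.keys p" by (auto simp: in_keys_iff)
  then show ?thesis by (simp add: free_lift_alt[of "Poly_Mapping.keys p"] scale_sum_right)
qed
lemma free_lift_linear: "Vector_Spaces.linear free_scale scale (free_lift scale f)"
proof -
  interpret F: vector_space free_scale by (rule vector_space_free_scale)
  show ?thesis
    by (unfold_locales) (auto simp: free_lift_add free_lift_scale)
qed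
end

text \<open>A bilinear map out of \<open>V \<times> W\<close> factors through \<open>V \<otimes> W\<close>.\<close>

lemma free_lift_tensor_cong:
  assumes "vector_space sV" "vector_space sW" "vector_space sU"
   and "\<And>w. Vector_Spaces.linear sV sU (\<lambda>v. f (v,w))"
   and "\<And>v. Vector_Spaces.linear sW sU (\<lambda>w. f (v,w))"
   and "tensor_eq sV sW p q"
  shows "free_lift sU f p = free_lift sU f q"
proof -
  interpret U: vector_space sU by fact
  interpret L: Vector_Spaces.linear free_scale sU "free_lift sU f" by (rule U.free_lift_linear)
  have "free_lift sU f (p - q) = 0"
    apply (rule L.eq_0_on_span[OF _ assms(6)[unfolded tensor_eq_def tensor_null_def]])
    using assms(4,5)
    by (auto simp: L.diff L.scale Vector_Spaces.linear_def module_hom_def module_hom_axioms_def)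
  then show ?thesis by (simp add: L.diff)
qed

text \<open>
  Representatives of the elements of \<open>V \<otimes> W\<close> that lie in the image of \<open>X \<otimes> Y\<close>, for
  subspaces \<open>X\<close> of \<open>V\<close> and \<open>Y\<close> of \<open>W\<close>; over a field that image is \<open>X \<otimes> Y\<close> itself.
\<close>

definition tensor_sub ::
  "('k::field \<Rightarrow> 'v::ab_group_add \<Rightarrow> 'v) \<Rightarrow> ('k \<Rightarrow> 'w::ab_group_add \<Rightarrow> 'w) \<Rightarrow>
    'v set \<Rightarrow> 'w set \<Rightarrow> ('v \<times> 'w \<Rightarrow>\<^sub>0 'k) set"
  where "tensor_sub sV sW X Y = {p. \<exists>q. Poly_Mapping.keys q \<subseteq> X \<times> Y \<and> tensor_eq sV sW p q}"

text \<open>The product \<open>(v \<otimes> w)(v' \<otimes> w') = vv' \<otimes> ww'\<close> on the tensor product of two algebras.\<close>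

definition tensor_mult ::
  "('v::ring_1 \<times> 'w::ring_1 \<Rightarrow>\<^sub>0 'k::field) \<Rightarrow> ('v \<times> 'w \<Rightarrow>\<^sub>0 'k) \<Rightarrow> ('v \<times> 'w \<Rightarrow>\<^sub>0 'k)"
  where "tensor_mult p q =
    free_bind p (\<lambda>(v, w). free_bind q (\<lambda>(v', w'). pure (v * v', w * w')))"

text \<open>The maps \<open>f \<otimes> id\<close> and \<open>id \<otimes> f\<close> for \<open>f\<close> with values in a tensor product.\<close>

definition tensor_map_left ::
  "('v \<Rightarrow> ('x \<times> 'y \<Rightarrow>\<^sub>0 'k::field)) \<Rightarrow> ('v \<times> 'w \<Rightarrow>\<^sub>0 'k) \<Rightarrow> ('x \<times> 'y \<times> 'w \<Rightarrow>\<^sub>0 'k)"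
  where "tensor_map_left f p = free_bind p (\<lambda>(v, w). free_bind (f v) (\<lambda>(x, y). pure (x, y, w)))"

definition tensor_map_right ::
  "('w \<Rightarrow> ('x \<times> 'y \<Rightarrow>\<^sub>0 'k::field)) \<Rightarrow> ('v \<times> 'w \<Rightarrow>\<^sub>0 'k) \<Rightarrow> ('v \<times> 'x \<times> 'y \<Rightarrow>\<^sub>0 'k)"
  where "tensor_map_right f p = free_bind p (\<lambda>(v, w). free_bind (f w) (\<lambda>(x, y). pure (v, x, y)))"


section \<open>Hopf algebras and comodule algebras\<close>

text \<open>
  Associative unital algebras.  The class \<open>ring_1\<close> includes \<open>0 \<noteq> 1\<close>; this loses nothing,
  since a Hopf algebra is nonzero (its counit maps \<open>1\<close> to \<open>1\<close>), and so is an
  \<open>H\<close>-simple algebra.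
\<close>

locale k_algebra = vector_space scale
  for scale :: "'k::field \<Rightarrow> 'a::ring_1 \<Rightarrow> 'a" +
  assumes scale_mult_left: "scale c x * y = scale c (x * y)"
    and scale_mult_right: "x * scale c y = scale c (x * y)"

text \<open>
  A linear map \<open>f : A \<rightarrow> V \<otimes> W\<close> is given by a choice of representatives \<open>f a\<close>,
  so additivity and homogeneity hold up to \<open>tensor_eq\<close>.
\<close>

definition tensor_linear ::
  "('k::field \<Rightarrow> 'a::ab_group_add \<Rightarrow> 'a) \<Rightarrow> ('k \<Rightarrow> 'v::ab_group_add \<Rightarrow> 'v) \<Rightarrow>
    ('k \<Rightarrow> 'w::ab_group_add \<Rightarrow> 'w) \<Rightarrow> ('a \<Rightarrow> ('v \<times> 'w \<Rightarrow>\<^sub>0 'k)) \<Rightarrow> bool"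
  where "tensor_linear sA sV sW f \<longleftrightarrow>
    (\<forall>a b. tensor_eq sV sW (f (a + b)) (f a + f b)) \<and>
    (\<forall>c a. tensor_eq sV sW (f (sA c a)) (free_scale c (f a)))"

definition tensor_algebra_map ::
  "('k::field \<Rightarrow> 'a::ring_1 \<Rightarrow> 'a) \<Rightarrow> ('k \<Rightarrow> 'v::ring_1 \<Rightarrow> 'v) \<Rightarrow>
    ('k \<Rightarrow> 'w::ring_1 \<Rightarrow> 'w) \<Rightarrow> ('a \<Rightarrow> ('v \<times> 'w \<Rightarrow>\<^sub>0 'k)) \<Rightarrow> bool"
  where "tensor_algebra_map sA sV sW f \<longleftrightarrow>
    tensor_linear sA sV sW f \<and>
    (\<forall>a b. tensor_eq sV sW (f (a * b)) (tensor_mult (f a) (f b))) \<and>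
    tensor_eq sV sW (f 1) (pure (1, 1))"

locale bialgebra = k_algebra sH
  for sH :: "'k::field \<Rightarrow> 'h::ring_1 \<Rightarrow> 'h" +
  fixes comult :: "'h \<Rightarrow> ('h \<times> 'h \<Rightarrow>\<^sub>0 'k)"
    and counit :: "'h \<Rightarrow> 'k"
  assumes comult_algebra_map: "tensor_algebra_map sH sH sH comult"
    and coassoc: "tensor3_eq sH sH sH
          (tensor_map_left comult (comult h)) (tensor_map_right comult (comult h))"
    and counit_linear: "Vector_Spaces.linear sH (*) counit"
    and counit_mult: "counit (g * h) = counit g * counit h"
    and counit_one: "counit 1 = 1"
    and counit_left: "free_lift sH (\<lambda>(x, y). sH (counit x) y) (comult h) = h"
    and counit_right: "free_lift sH (\<lambda>(x, y). sH (counit y) x) (comult h) = h"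

locale hopf_algebra = bialgebra sH comult counit
  for sH :: "'k::field \<Rightarrow> 'h::ring_1 \<Rightarrow> 'h"
    and comult :: "'h \<Rightarrow> ('h \<times> 'h \<Rightarrow>\<^sub>0 'k)"
    and counit :: "'h \<Rightarrow> 'k" +
  fixes antipode :: "'h \<Rightarrow> 'h"
  assumes antipode_linear: "Vector_Spaces.linear sH sH antipode"
    and antipode_left: "free_lift sH (\<lambda>(x, y). antipode x * y) (comult h) = sH (counit h) 1"
    and antipode_right: "free_lift sH (\<lambda>(x, y). x * antipode y) (comult h) = sH (counit h) 1"

definition subcoalgebra ::
  "('k::field \<Rightarrow> 'h::ab_group_add \<Rightarrow> 'h) \<Rightarrow> ('h \<Rightarrow> ('h \<times> 'h \<Rightarrow>\<^sub>0 'k)) \<Rightarrow> 'h set \<Rightarrow> bool"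
  where "subcoalgebra sH comult C \<longleftrightarrow>
    module.subspace sH C \<and> (\<forall>c\<in>C. comult c \<in> tensor_sub sH sH C C)"

definition simple_subcoalgebra ::
  "('k::field \<Rightarrow> 'h::ab_group_add \<Rightarrow> 'h) \<Rightarrow> ('h \<Rightarrow> ('h \<times> 'h \<Rightarrow>\<^sub>0 'k)) \<Rightarrow> 'h set \<Rightarrow> bool"
  where "simple_subcoalgebra sH comult C \<longleftrightarrow>
    subcoalgebra sH comult C \<and> C \<noteq> {0} \<and>
    (\<forall>D. subcoalgebra sH comult D \<and> D \<subseteq> C \<longrightarrow> D = {0} \<or> D = C)"

definition pointed ::
  "('k::field \<Rightarrow> 'h::ab_group_add \<Rightarrow> 'h) \<Rightarrow> ('h \<Rightarrow> ('h \<times> 'h \<Rightarrow>\<^sub>0 'k)) \<Rightarrow> bool"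
  where "pointed sH comult \<longleftrightarrow>
    (\<forall>C. simple_subcoalgebra sH comult C \<longrightarrow> vector_space.dim sH C = 1)"

locale comodule_algebra = H: hopf_algebra sH comult counit antipode + A: k_algebra sA
  for sH :: "'k::field \<Rightarrow> 'h::ring_1 \<Rightarrow> 'h"
    and comult :: "'h \<Rightarrow> ('h \<times> 'h \<Rightarrow>\<^sub>0 'k)"
    and counit :: "'h \<Rightarrow> 'k"
    and antipode :: "'h \<Rightarrow> 'h"
    and sA :: "'k \<Rightarrow> 'a::ring_1 \<Rightarrow> 'a" +
  fixes coact :: "'a \<Rightarrow> ('h \<times> 'a \<Rightarrow>\<^sub>0 'k)"
  assumes coact_algebra_map: "tensor_algebra_map sA sH sA coact"
    and coact_coassoc: "tensor3_eq sH sH sA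
          (tensor_map_left comult (coact a)) (tensor_map_right coact (coact a))"
    and coact_counit: "free_lift sA (\<lambda>(h, b). sA (counit h) b) (coact a) = a"

definition subcomodule ::
  "('k::field \<Rightarrow> 'h::ab_group_add \<Rightarrow> 'h) \<Rightarrow> ('k \<Rightarrow> 'a::ab_group_add \<Rightarrow> 'a) \<Rightarrow>
    ('a \<Rightarrow> ('h \<times> 'a \<Rightarrow>\<^sub>0 'k)) \<Rightarrow> 'a set \<Rightarrow> bool"
  where "subcomodule sH sA coact V \<longleftrightarrow>
    module.subspace sA V \<and> (\<forall>v\<in>V. coact v \<in> tensor_sub sH sA UNIV V)"

definition right_ideal :: "'a::ring_1 set \<Rightarrow> bool"
  where "right_ideal I \<longleftrightarrow>
    0 \<in> I \<and> (\<forall>x\<in>I. \<forall>y\<in>I. x - y \<in> I) \<and> (\<forall>x\<in>I. \<forall>a. x * a \<in> I)"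

definition right_H_simple ::
  "('k::field \<Rightarrow> 'h::ab_group_add \<Rightarrow> 'h) \<Rightarrow> ('k \<Rightarrow> 'a::ring_1 \<Rightarrow> 'a) \<Rightarrow>
    ('a \<Rightarrow> ('h \<times> 'a \<Rightarrow>\<^sub>0 'k)) \<Rightarrow> bool"
  where "right_H_simple sH sA coact \<longleftrightarrow>
    (UNIV :: 'a set) \<noteq> {0} \<and>
    (\<forall>I. right_ideal I \<and> subcomodule sH sA coact I \<longrightarrow> I = {0} \<or> I = UNIV)"

definition coinvariants ::
  "('k::field \<Rightarrow> 'h::ring_1 \<Rightarrow> 'h) \<Rightarrow> ('k \<Rightarrow> 'a::ring_1 \<Rightarrow> 'a) \<Rightarrow>
    ('a \<Rightarrow> ('h \<times> 'a \<Rightarrow>\<^sub>0 'k)) \<Rightarrow> 'a set"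
  where "coinvariants sH sA coact = {a. tensor_eq sH sA (coact a) (pure (1, a))}"

end

theory Submission
  imports Defs "HOL-Library.Function_Algebras"
begin

text \<open>
  In the category of Hopf modules (right \<open>A\<close>-modules with a compatible \<open>H\<close>-coaction) a vector of
  grouplike weight \<open>g\<close> generates a copy of \<open>A\<close> twisted by \<open>g\<close>, because \<open>A\<close> is right \<open>H\<close>-simple; as
  \<open>H\<close> is pointed, every nonzero quotient of Hopf modules contains such a vector, so dimensions of
  Hopf modules are multiples of \<open>dim A\<close>.  It remains to find a Hopf module of dimension \<open>dim H\<close>.
  Trivial coinvariants make the weight spaces of \<open>A\<close> lines spanned by units, over a group \<open>F\<close> of
  weights.  In the cofree Hopf module \<open>Hom(A, H)\<close> one picks a vector of each grouplike weight,
  compatibly along the cosets of \<open>F\<close>, and divides by a Hopf submodule \<open>Z\<close> maximal without containing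
  any of them.  The quotient then has exactly one line of vectors for each grouplike weight.  A functional
  that is nonzero on these lines embeds it into \<open>H\<close>, and a comodule map from \<open>H\<close> hitting these
  lines embeds \<open>H\<close> into it.  The coaction is handled throughout as an action of the functionals on \<open>H\<close>.
\<close>

section \<open>Tensors by representatives\<close>

text \<open>\<open>A\<close> embeds into \<open>H\<close> as a comodule, but in general not as an
  algebra: a twisted group algebra of a commutative group can be noncommutative. So \<open>H\<close>
  carries no evident action of \<open>A\<close>, and the cofree Hopf module, of dimension
  \<open>dim H * dim A\<close>, says nothing about divisibility. Its defect is that each grouplike
  weight occurs with multiplicity \<open>dim A\<close>; dividing by \<open>Z\<close> cuts every
  multiplicity to one, as in \<open>H\<close>.

  The vectors to be avoided cannot be chosen freely. If \<open>v\<close> of weight \<open>g\<close>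
  survives modulo \<open>Z\<close>, maximality puts an avoided vector of some weight
  \<open>g'\<close> into \<open>Z + v A\<close>. Its coefficient in \<open>A\<close> is a unit, and
  the inverse of that unit has to carry the avoided vector of weight \<open>g'\<close> to a multiple
  of the one of weight \<open>g\<close>. Compatibility along the cosets of \<open>F\<close>
  guarantees this.

  Tensors are given by representatives, so comodule identities hold only up to
  \<open>tensor_eq\<close>; contraction with functionals on \<open>H\<close> turns them into
  equations between elements.\<close>

lemma vector_space_field: "vector_space ((*) :: 'k::field \<Rightarrow> 'k \<Rightarrow> 'k)"
  by unfold_locales (auto simp: algebra_simps)

lemma linearI:
  assumes "vector_space s" "vector_space s'"
    and "\<And>x y. f (x + y) = f x + f y" "\<And>c x. f (s c x) = s' c (f x)"
  shows "Vector_Spaces.linear s s' f"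
  using assms by (simp add: Vector_Spaces.linear_iff)

lemma linearD:
  assumes "Vector_Spaces.linear s s' f"
  shows linear_addD: "f (x + y) = f x + f y"
    and linear_scaleD: "f (s c x) = s' c (f x)"
    and linear_zeroD: "f 0 = 0"
    and linear_diffD: "f (x - y) = f x - f y"
    and linear_sumD: "f (sum h S) = (\<Sum>i\<in>S. f (h i))"
proof -
  interpret Vector_Spaces.linear s s' f by fact
  show "f (x + y) = f x + f y" "f (s c x) = s' c (f x)" "f 0 = 0" "f (x - y) = f x - f y"
    "f (sum h S) = (\<Sum>i\<in>S. f (h i))"
    by (auto simp: add scale diff sum)
qed

lemma linear_compD:
  "Vector_Spaces.linear s s' f \<Longrightarrow> Vector_Spaces.linear s' s'' g \<Longrightarrow> Vector_Spaces.linear s s'' (\<lambda>x. g (f x))"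
  by (simp add: Vector_Spaces.linear_iff)

lemma linear_free_lift:
  assumes "Vector_Spaces.linear s s' L"
  shows "L (free_lift s f p) = free_lift s' (\<lambda>x. L (f x)) p"
  by (simp add: free_lift_def linear_sumD[OF assms] linear_scaleD[OF assms])

lemma free_lift_bind:
  assumes "vector_space s"
  shows "free_lift s F (free_bind p G) = free_lift s (\<lambda>x. free_lift s F (G x)) p"
  by (rule linear_free_lift[OF vector_space.free_lift_linear[OF assms]])

lemma free_lift_cong:
  "(\<And>x. x \<in> Poly_Mapping.keys p \<Longrightarrow> f x = g x) \<Longrightarrow> free_lift s f p = free_lift s g p"
  by (simp add: free_lift_def)

lemma free_lift_fun_add:
  assumes "vector_space s"
  shows "free_lift s (\<lambda>x. f x + g x) p = free_lift s f p + free_lift s g p"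
proof -
  interpret vector_space s by fact
  show ?thesis by (simp add: free_lift_def scale_right_distrib sum.distrib)
qed

lemma free_lift_fun_scale:
  assumes "vector_space s"
  shows "free_lift s (\<lambda>x. s c (f x)) p = s c (free_lift s f p)"
proof -
  interpret vector_space s by fact
  show ?thesis by (simp add: free_lift_def scale_sum_right mult.commute)
qed

lemma free_lift_fun_diff:
  assumes "vector_space s"
  shows "free_lift s (\<lambda>x. f x - g x) p = free_lift s f p - free_lift s g p"
proof -
  interpret vector_space s by fact
  show ?thesis by (simp add: free_lift_def scale_right_diff_distrib sum_subtractf)
qed

lemma free_lift_in_subspace:
  assumes "vector_space s" "module.subspace s X" "\<And>x. x \<in> Poly_Mapping.keys p \<Longrightarrow> f x \<in> X"
  shows "free_lift s f p \<in> X"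
proof -
  interpret vector_space s by fact
  show ?thesis unfolding free_lift_def
    using assms(2,3) by (intro subspace_sum subspace_scale) auto
qed

lemma free_lift_tensor3_cong:
  assumes "vector_space sX" "vector_space sV" "vector_space sW" "vector_space sU"
    and "\<And>v w. Vector_Spaces.linear sX sU (\<lambda>x. f (x, v, w))"
    and "\<And>x w. Vector_Spaces.linear sV sU (\<lambda>v. f (x, v, w))"
    and "\<And>x v. Vector_Spaces.linear sW sU (\<lambda>w. f (x, v, w))"
    and "tensor3_eq sX sV sW p q"
  shows "free_lift sU f p = free_lift sU f q"
proof -
  interpret U: vector_space sU by fact
  interpret L: Vector_Spaces.linear free_scale sU "free_lift sU f" by (rule U.free_lift_linear)
  have "free_lift sU f (p - q) = 0"
    apply (rule L.eq_0_on_span[OF _ assms(8)[unfolded tensor3_eq_def tensor3_null_def]])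
    using assms(5-7) by (auto simp: L.diff L.scale Vector_Spaces.linear_iff)
  then show ?thesis by (simp add: L.diff)
qed

section \<open>Calculus of tensors modulo the bilinearity relations\<close>

lemma tensor_eq_refl: "tensor_eq sV sW p p"
  and tensor_eq_sym: "tensor_eq sV sW p q \<Longrightarrow> tensor_eq sV sW q p"
  and tensor_eq_trans: "tensor_eq sV sW p q \<Longrightarrow> tensor_eq sV sW q r \<Longrightarrow> tensor_eq sV sW p r"
  and tensor_eq_add: "tensor_eq sV sW p q \<Longrightarrow> tensor_eq sV sW p' q' \<Longrightarrow> tensor_eq sV sW (p + p') (q + q')"
  and tensor_eq_scale: "tensor_eq sV sW p q \<Longrightarrow> tensor_eq sV sW (free_scale c p) (free_scale c q)"
proof -
  interpret vector_space free_scale by (rule vector_space_free_scale)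
  show "tensor_eq sV sW p p"
    by (simp add: tensor_eq_def tensor_null_def span_zero)
  show "tensor_eq sV sW p q \<Longrightarrow> tensor_eq sV sW q p"
    unfolding tensor_eq_def tensor_null_def using span_neg[of "p - q"] by simp
  show "tensor_eq sV sW p q \<Longrightarrow> tensor_eq sV sW q r \<Longrightarrow> tensor_eq sV sW p r"
    unfolding tensor_eq_def tensor_null_def using span_add[of "p - q" _ "q - r"] by simp
  show "tensor_eq sV sW p q \<Longrightarrow> tensor_eq sV sW p' q' \<Longrightarrow> tensor_eq sV sW (p + p') (q + q')"
    unfolding tensor_eq_def tensor_null_def using span_add[of "p - q" _ "p' - q'"] by (simp add: algebra_simps)
  show "tensor_eq sV sW p q \<Longrightarrow> tensor_eq sV sW (free_scale c p) (free_scale c q)"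
    unfolding tensor_eq_def tensor_null_def using span_scale[of "p - q" _ c]
    by (simp add: scale_right_diff_distrib)
qed

lemma tensor_eq_sum:
  "(\<And>i. i \<in> I \<Longrightarrow> tensor_eq sV sW (p i) (q i)) \<Longrightarrow> tensor_eq sV sW (sum p I) (sum q I)"
  by (induction I rule: infinite_finite_induct) (auto intro: tensor_eq_refl tensor_eq_add)

lemma
  shows tensor_eq_pure_add_left: "tensor_eq sV sW (pure (v + v', w)) (pure (v, w) + pure (v', w))"
    and tensor_eq_pure_add_right: "tensor_eq sV sW (pure (v, w + w')) (pure (v, w) + pure (v, w'))"
    and tensor_eq_pure_scale_left: "tensor_eq sV sW (pure (sV c v, w)) (free_scale c (pure (v, w)))"
    and tensor_eq_pure_scale_right: "tensor_eq sV sW (pure (v, sW c w)) (free_scale c (pure (v, w)))"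
proof -
  interpret vector_space free_scale by (rule vector_space_free_scale)
  show "tensor_eq sV sW (pure (v + v', w)) (pure (v, w) + pure (v', w))"
    unfolding tensor_eq_def tensor_null_def diff_diff_eq[symmetric] by (rule span_base) blast
  show "tensor_eq sV sW (pure (v, w + w')) (pure (v, w) + pure (v, w'))"
    unfolding tensor_eq_def tensor_null_def diff_diff_eq[symmetric] by (rule span_base) blast
  show "tensor_eq sV sW (pure (sV c v, w)) (free_scale c (pure (v, w)))"
    unfolding tensor_eq_def tensor_null_def by (rule span_base) blast
  show "tensor_eq sV sW (pure (v, sW c w)) (free_scale c (pure (v, w)))"
    unfolding tensor_eq_def tensor_null_def by (rule span_base) blast
qed

lemma free_scale_zero: "free_scale 0 p = 0"
  by (rule poly_mapping_eqI) simp

lemma free_expand: "p = (\<Sum>x\<in>Poly_Mapping.keys p. free_scale (Poly_Mapping.lookup p x) (pure x))"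
  by (rule poly_mapping_eqI)
     (simp add: lookup_sum pure_def lookup_single when_def if_distrib sum.delta in_keys_iff cong: if_cong)

lemma tensor_eq_pure_zero_left:
  assumes "vector_space sV" shows "tensor_eq sV sW (pure (0, w)) 0"
proof -
  interpret vector_space sV by fact
  show ?thesis using tensor_eq_pure_scale_left[of sV sW 0 0 w] by (simp add: free_scale_zero)
qed

lemma tensor_eq_pure_zero_right:
  assumes "vector_space sW" shows "tensor_eq sV sW (pure (v, 0)) 0"
proof -
  interpret vector_space sW by fact
  show ?thesis using tensor_eq_pure_scale_right[of sV sW v 0 0] by (simp add: free_scale_zero)
qed

lemma tensor_eq_pure_sum_left:
  assumes "vector_space sV"
  shows "tensor_eq sV sW (pure (sum f I, w)) (\<Sum>i\<in>I. pure (f i, w))"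
proof (induction I rule: infinite_finite_induct)
  case (insert i I)
  then show ?case
    using tensor_eq_trans[OF tensor_eq_pure_add_left tensor_eq_add[OF tensor_eq_refl]] by simp
qed (auto intro: tensor_eq_pure_zero_left[OF assms])

section \<open>Contraction of the left tensor factor with a functional\<close>

definition contract :: "('k::field \<Rightarrow> 'v::ab_group_add \<Rightarrow> 'v) \<Rightarrow> ('x \<Rightarrow> 'k) \<Rightarrow> ('x \<times> 'v \<Rightarrow>\<^sub>0 'k) \<Rightarrow> 'v"
  where "contract s f p = free_lift s (\<lambda>(x, v). s (f x) v) p"

lemma contract_pure: "vector_space s \<Longrightarrow> contract s f (pure (x, v)) = s (f x) v"
  by (simp add: contract_def vector_space.free_lift_pure)

lemma contract_linear: "vector_space s \<Longrightarrow> Vector_Spaces.linear free_scale s (contract s f)"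
  unfolding contract_def by (rule vector_space.free_lift_linear)

lemma contract_cong:
  assumes "vector_space sH" "vector_space sV" "Vector_Spaces.linear sH (*) f" "tensor_eq sH sV p q"
  shows "contract sV f p = contract sV f q"
  unfolding contract_def
proof (rule free_lift_tensor_cong[OF assms(1,2,2) _ _ assms(4)])
  interpret V: vector_space sV by fact
  fix v w
  show "Vector_Spaces.linear sH sV (\<lambda>v. case (v, w) of (x, v) \<Rightarrow> sV (f x) v)"
    using assms(3) by (auto intro!: linearI assms simp: Vector_Spaces.linear_iff V.scale_left_distrib)
  show "Vector_Spaces.linear sV sV (\<lambda>w. case (v, w) of (x, v) \<Rightarrow> sV (f x) v)"
    by (auto intro!: linearI assms simp: V.scale_right_distrib mult.commute)
qed

lemma contract_fun_add:
  assumes "vector_space s"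
  shows "contract s (\<lambda>x. f x + g x) p = contract s f p + contract s g p"
proof -
  interpret vector_space s by fact
  show ?thesis
    by (simp add: contract_def free_lift_fun_add[OF assms, symmetric] case_prod_unfold scale_left_distrib)
qed

lemma contract_fun_scale:
  assumes "vector_space s"
  shows "contract s (\<lambda>x. c * f x) p = s c (contract s f p)"
proof -
  interpret vector_space s by fact
  show ?thesis
    by (simp add: contract_def free_lift_fun_scale[OF assms, symmetric] case_prod_unfold)
qed

text \<open>Both sides respect sums and scalars in \<open>p\<close>, so pure tensors suffice, and
  there the scalar \<open>representation B x i\<close> moves across the tensor sign. A tensor is
  thus determined by finitely many contractions.\<close>

lemma tensor_eq_expand:
  fixes sH :: "'k::field \<Rightarrow> 'h::ab_group_add \<Rightarrow> 'h" and sV :: "'k \<Rightarrow> 'v::ab_group_add \<Rightarrow> 'v"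
  assumes vH: "vector_space sH" and vV: "vector_space sV"
    and B: "finite B" "\<not> module.dependent sH B" "module.span sH B = UNIV"
  shows "tensor_eq sH sV p (\<Sum>i\<in>B. pure (i, contract sV (\<lambda>x. module.representation sH B x i) p))"
proof -
  interpret H: vector_space sH by fact
  interpret V: vector_space sV by fact
  interpret F: vector_space free_scale by (rule vector_space_free_scale)
  define R :: "('h \<times> 'v \<Rightarrow>\<^sub>0 'k) \<Rightarrow> ('h \<times> 'v \<Rightarrow>\<^sub>0 'k)" where "R p = (\<Sum>i\<in>B. pure (i, contract sV (\<lambda>x. H.representation B x i) p))" for p
  have R_pure: "tensor_eq sH sV (pure (x, v)) (R (pure (x, v)))" for x v
  proof -
    have x: "(\<Sum>i\<in>B. sH (H.representation B x i) i) = x"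
      using H.sum_representation_eq[OF B(2) _ B(1), of x] B(3) by simp
    have "tensor_eq sH sV (pure (\<Sum>i\<in>B. sH (H.representation B x i) i, v))
        (\<Sum>i\<in>B. pure (sH (H.representation B x i) i, v))"
      by (rule tensor_eq_pure_sum_left[OF vH])
    moreover have "tensor_eq sH sV (\<Sum>i\<in>B. pure (sH (H.representation B x i) i, v)) (R (pure (x, v)))"
      unfolding R_def
    proof (rule tensor_eq_sum)
      fix i
      show "tensor_eq sH sV (pure (sH (H.representation B x i) i, v))
          (pure (i, contract sV (\<lambda>x. H.representation B x i) (pure (x, v))))"
        unfolding contract_pure[OF vV]
        by (rule tensor_eq_trans[OF tensor_eq_pure_scale_left tensor_eq_sym[OF tensor_eq_pure_scale_right]])
    qed
    ultimately have "tensor_eq sH sV (pure (\<Sum>i\<in>B. sH (H.representation B x i) i, v)) (R (pure (x, v)))"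
      by (rule tensor_eq_trans)
    then show ?thesis unfolding x .
  qed
  have R_add: "tensor_eq sH sV (R p + R q) (R (p + q))" for p q
    unfolding R_def sum.distrib[symmetric] linear_addD[OF contract_linear[OF vV]]
    by (intro tensor_eq_sum tensor_eq_sym[OF tensor_eq_pure_add_right])
  have R_scale: "tensor_eq sH sV (free_scale c (R p)) (R (free_scale c p))" for c p
    unfolding R_def F.scale_sum_right linear_scaleD[OF contract_linear[OF vV]]
    by (intro tensor_eq_sum tensor_eq_sym[OF tensor_eq_pure_scale_right])
  have R_zero: "tensor_eq sH sV 0 (R 0)"
    unfolding R_def linear_zeroD[OF contract_linear[OF vV]]
    using tensor_eq_sum[of B sH sV "\<lambda>_. 0" "\<lambda>i. pure (i, 0)"] tensor_eq_sym[OF tensor_eq_pure_zero_right[OF vV, of sH]]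
    by simp
  have R_sum: "tensor_eq sH sV (\<Sum>x\<in>S. free_scale (c x) (pure x)) (R (\<Sum>x\<in>S. free_scale (c x) (pure x)))"
    for S :: "('h \<times> 'v) set" and c
  proof (induction S rule: infinite_finite_induct)
    case (insert y S)
    obtain x v where y: "y = (x, v)" by (cases y)
    have "tensor_eq sH sV (free_scale (c y) (pure y)) (R (free_scale (c y) (pure y)))"
      unfolding y by (rule tensor_eq_trans[OF tensor_eq_scale[OF R_pure] R_scale])
    with insert show ?case
      using tensor_eq_trans[OF tensor_eq_add R_add] by simp
  qed (auto intro: R_zero)
  from R_sum[of "Poly_Mapping.lookup p" "Poly_Mapping.keys p"] show ?thesis
    unfolding free_expand[of p, symmetric] R_def .
qed

lemma contract_tensor_linear:
  assumes "vector_space sA" "vector_space sH" "vector_space sV"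
    and "Vector_Spaces.linear sH (*) f" "tensor_linear sA sH sV \<delta>"
  shows "Vector_Spaces.linear sA sV (\<lambda>a. contract sV f (\<delta> a))"
proof (rule linearI[OF assms(1,3)])
  note c = contract_cong[OF assms(2,3,4)] and l = contract_linear[OF assms(3)]
  fix a b c
  show "contract sV f (\<delta> (a + b)) = contract sV f (\<delta> a) + contract sV f (\<delta> b)"
    using assms(5) c linear_addD[OF l] unfolding tensor_linear_def by metis
  show "contract sV f (\<delta> (sA c a)) = sV c (contract sV f (\<delta> a))"
    using assms(5) c linear_scaleD[OF l] unfolding tensor_linear_def by metis
qed

text \<open>Exchanging the two sums collects a contraction of \<open>p\<close> for each fixed pure
  term of \<open>q\<close>. For coactions this is \<open>f(a_{-1} b_{-1}) a_0 b_0\<close>, with the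
  sum belonging to \<open>b\<close> taken last.\<close>

lemma contract_mult:
  fixes sH :: "'k::field \<Rightarrow> 'h::ring_1 \<Rightarrow> 'h" and sA :: "'k \<Rightarrow> 'a::ring_1 \<Rightarrow> 'a"
  assumes "vector_space sH" and "k_algebra sA"
    and "Vector_Spaces.linear sH (*) f" "tensor_eq sH sA r (tensor_mult p q)"
  shows "contract sA f r = free_lift sA (\<lambda>(x, b). contract sA (\<lambda>h. f (h * x)) p * b) q"
proof -
  interpret k_algebra sA by fact
  have vA: "vector_space sA" by unfold_locales
  have "contract sA f r = contract sA f (tensor_mult p q)"
    by (rule contract_cong[OF assms(1) vA assms(3,4)])
  also have "\<dots> = free_lift sA (\<lambda>(v, w). free_lift sA (\<lambda>(v', w'). sA (f (v * v')) (w * w')) q) p"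
    unfolding contract_def tensor_mult_def free_lift_bind[OF vA]
    by (simp add: case_prod_unfold free_lift_bind[OF vA])
  also have "\<dots> = free_lift sA (\<lambda>(v', w'). free_lift sA (\<lambda>(v, w). sA (f (v * v')) (w * w')) p) q"
    unfolding free_lift_def case_prod_unfold scale_sum_right
    by (subst sum.swap) (simp add: mult.left_commute)
  also have "\<dots> = free_lift sA (\<lambda>(x, b). contract sA (\<lambda>h. f (h * x)) p * b) q"
    unfolding contract_def free_lift_def case_prod_unfold sum_distrib_right
    by (simp add: scale_mult_left)
  finally show ?thesis .
qed

text \<open>Coassociativity relates only classes of triples. A trilinear \<open>F\<close> takes the
  same value on equal classes, which gives \<open>F(v_1, v_2, w) = F(v, w_{-1}, w_0)\<close>, summed
  along \<open>p\<close>.\<close>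

lemma coassoc_apply:
  assumes "vector_space sH" "vector_space sV" "vector_space sU"
    and "\<And>v w. Vector_Spaces.linear sH sU (\<lambda>x. F x v w)"
    and "\<And>x w. Vector_Spaces.linear sH sU (\<lambda>v. F x v w)"
    and "\<And>x v. Vector_Spaces.linear sV sU (\<lambda>w. F x v w)"
    and "tensor3_eq sH sH sV (tensor_map_left comult p) (tensor_map_right \<delta> p)"
  shows "free_lift sU (\<lambda>(v, w). free_lift sU (\<lambda>(x, y). F x y w) (comult v)) p
    = free_lift sU (\<lambda>(v, w). free_lift sU (\<lambda>(x, y). F v x y) (\<delta> w)) p"
proof -
  interpret U: vector_space sU by fact
  have "free_lift sU (\<lambda>(x, y, w). F x y w) (tensor_map_left comult p)
      = free_lift sU (\<lambda>(x, y, w). F x y w) (tensor_map_right \<delta> p)"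
    by (rule free_lift_tensor3_cong[OF assms(1,1,2,3) _ _ _ assms(7)]) (use assms in simp_all)
  then show ?thesis
    unfolding tensor_map_left_def tensor_map_right_def free_lift_bind[OF assms(3)]
    by (simp add: case_prod_unfold free_lift_bind[OF assms(3)])
qed

text \<open>The \<open>L i\<close> are independent modulo \<open>Z\<close>, so together with a basis
  of \<open>Z\<close> they form an independent set, on which values can be prescribed. Working
  modulo \<open>Z\<close> replaces the formation of a quotient space.\<close>

lemma ex_functional_mod:
  fixes s :: "'k::field \<Rightarrow> 'v::ab_group_add \<Rightarrow> 'v"
  assumes vs: "vector_space s" and Z: "module.subspace s Z"
    and indep: "\<And>S u i. finite S \<Longrightarrow> S \<subseteq> I \<Longrightarrow> (\<Sum>i\<in>S. s (u i) (L i)) \<in> Z \<Longrightarrow> i \<in> S \<Longrightarrow> u i = 0"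
  shows "\<exists>l. Vector_Spaces.linear s (*) l \<and> (\<forall>z\<in>Z. l z = 0) \<and> (\<forall>i\<in>I. l (L i) = c i)"
proof -
  interpret vector_space s by fact
  interpret vector_space_pair s "(*) :: 'k \<Rightarrow> 'k \<Rightarrow> 'k"
    unfolding vector_space_pair_def using vs vector_space_field by auto
  obtain C where C: "C \<subseteq> Z" "independent C" "Z \<subseteq> span C"
    using maximal_independent_subset by blast
  have L_notin: "L i \<notin> Z" if "i \<in> I" for i
    using indep[of "{i}" "\<lambda>_. 1" i] that by auto
  have inj: "inj_on L I"
  proof (rule inj_onI, rule ccontr)
    fix i j assume ij: "i \<in> I" "j \<in> I" "L i = L j" "i \<noteq> j"
    then show False
      using indep[of "{i, j}" "\<lambda>x. if x = i then 1 else -1" i] subspace_0[OF Z] by auto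
  qed
  have "independent (C \<union> L ` I)"
    unfolding independent_explicit_finite_subsets
  proof (intro allI impI)
    fix S u assume S: "S \<subseteq> C \<union> L ` I" "finite S" and sum0: "(\<Sum>v\<in>S. s (u v) v) = 0"
    define J where "J = {i \<in> I. L i \<in> S}"
    have injJ: "inj_on L J" using inj by (rule inj_on_subset) (auto simp: J_def)
    have SJ: "S = (S \<inter> C) \<union> L ` J" using S(1) by (auto simp: J_def)
    have "finite (L ` J)" by (rule finite_subset[OF _ S(2)]) (auto simp: J_def)
    then have finJ: "finite J" using injJ by (rule finite_imageD)
    have disj: "(S \<inter> C) \<inter> L ` J = {}" using L_notin C(1) by (auto simp: J_def)
    have split: "(\<Sum>v\<in>S \<inter> C. s (u v) v) + (\<Sum>i\<in>J. s (u (L i)) (L i)) = 0"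
    proof -
      have "(\<Sum>v\<in>S. s (u v) v) = (\<Sum>v\<in>S \<inter> C. s (u v) v) + (\<Sum>v\<in>L ` J. s (u v) v)"
        using sum.union_disjoint[OF _ _ disj, of "\<lambda>v. s (u v) v"] S(2) finJ SJ by simp
      then show ?thesis using sum0 by (simp add: sum.reindex[OF injJ])
    qed
    have "(\<Sum>v\<in>S \<inter> C. s (u v) v) \<in> Z"
      by (intro subspace_sum[OF Z] subspace_scale[OF Z]) (use C(1) in auto)
    then have "(\<Sum>i\<in>J. s (u (L i)) (L i)) \<in> Z"
      using subspace_neg[OF Z] split by (simp add: add_eq_0_iff)
    then have J0: "u (L i) = 0" if "i \<in> J" for i
      using indep[of J "\<lambda>i. u (L i)" i] finJ that by (auto simp: J_def)
    with split have "(\<Sum>v\<in>S \<inter> C. s (u v) v) = 0" by simp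
    then have "u v = 0" if "v \<in> S \<inter> C" for v
      using independentD[OF C(2), of "S \<inter> C"] S(2) that by auto
    with J0 show "\<forall>v\<in>S. u v = 0" using S(1) by (auto simp: J_def)
  qed
  from linear_independent_extend[OF this, of "\<lambda>v. if v \<in> C then 0 else c (the_inv_into I L v)"]
  obtain l where l: "Vector_Spaces.linear s (*) l"
    and lv: "\<And>x. x \<in> C \<union> L ` I \<Longrightarrow> l x = (if x \<in> C then 0 else c (the_inv_into I L x))" by blast
  have "l z = 0" if "z \<in> Z" for z
  proof -
    interpret l: Vector_Spaces.linear s "(*)" l by fact
    show ?thesis using l.eq_0_on_span[of C z] lv C that by auto
  qed
  moreover have "l (L i) = c i" if "i \<in> I" for i
    using lv[of "L i"] that L_notin[OF that] C(1) the_inv_into_f_f[OF inj that] by auto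
  ultimately show ?thesis using l by blast
qed

text \<open>Only the larger subspace has to be finitely spanned. The ambient space will be the space
  of all functions from \<open>A\<close> to \<open>H\<close>, or \<open>A\<close> before its
  dimension is known to be finite.\<close>

lemma (in vector_space) subspace_eqI_dim:
  assumes "subspace S" "subspace T" "S \<subseteq> T" "T \<subseteq> span F" "finite F" "dim T \<le> dim S"
  shows "S = T"
proof -
  obtain C where C: "C \<subseteq> S" "independent C" "S \<subseteq> span C" "card C = dim S"
    using basis_exists by blast
  obtain D where D: "C \<subseteq> D" "D \<subseteq> T" "independent D" "T \<subseteq> span D"
    using maximal_independent_subset_extend[of C T] C assms(3) by blast
  have finD: "finite D" using independent_span_bound[OF assms(5) D(3)] D(2) assms(4) by auto
  have "card D = dim T" using basis_card_eq_dim D by blast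
  then have "C = D" using card_seteq[OF finD D(1)] C(4) assms(6) by simp
  then show ?thesis using D(4) span_minimal[OF C(1) assms(1)] assms(3) by auto
qed

section \<open>Pointed Hopf algebras\<close>

locale pointed_hopf_algebra = hopf_algebra sH comult counit antipode
  for sH :: "'k::field \<Rightarrow> 'h::ring_1 \<Rightarrow> 'h"
    and comult :: "'h \<Rightarrow> ('h \<times> 'h \<Rightarrow>\<^sub>0 'k)"
    and counit :: "'h \<Rightarrow> 'k"
    and antipode :: "'h \<Rightarrow> 'h" +
  fixes B :: "'h set"
  assumes finite_dim: "finite_dimensional_vector_space sH B"
    and pointed: "pointed sH comult"
begin

sublocale finite_dimensional_vector_space sH B
  by (rule finite_dim)

lemma vH: "vector_space sH"
  by unfold_locales

lemma kH: "k_algebra sH"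
  by unfold_locales

lemma vK: "vector_space ((*) :: 'k \<Rightarrow> 'k \<Rightarrow> 'k)"
  by (rule vector_space_field)

section \<open>Functionals on H and their convolution\<close>

abbreviation lf :: "('h \<Rightarrow> 'k) \<Rightarrow> bool" where "lf f \<equiv> Vector_Spaces.linear sH (*) f"

definition coord :: "'h \<Rightarrow> 'h \<Rightarrow> 'k" where "coord i h = representation B h i"

lemma lf_representation:
  assumes "independent C" "span C = UNIV"
  shows "lf (\<lambda>h. representation C h i)"
  by (rule linearI[OF vH vK]) (use assms in \<open>auto simp: representation_add representation_scale\<close>)

lemma lf_coord: "lf (coord i)"
  using lf_representation[OF independent_Basis span_Basis, of i] by (simp add: coord_def[abs_def])

lemma coord_expand: "(\<Sum>i\<in>B. sH (coord i h) i) = h"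
  unfolding coord_def using independent_Basis span_Basis finite_Basis
  by (intro sum_representation_eq) auto

lemma lf_eqI:
  assumes "\<And>f. lf f \<Longrightarrow> f h = f h'"
  shows "h = h'"
proof -
  have "(\<Sum>i\<in>B. sH (coord i h) i) = (\<Sum>i\<in>B. sH (coord i h') i)"
    using assms[OF lf_coord] by simp
  then show ?thesis by (simp add: coord_expand)
qed

lemma lf_expand:
  assumes "lf f" shows "f h = (\<Sum>i\<in>B. f i * coord i h)"
proof -
  have "f h = f (\<Sum>i\<in>B. sH (coord i h) i)"
    by (simp add: coord_expand)
  then show ?thesis
    by (simp add: linear_sumD[OF assms] linear_scaleD[OF assms] mult.commute)
qed

lemma linear_mult_left: "Vector_Spaces.linear sH sH (\<lambda>h. x * h)"
  by (rule linearI[OF vH vH]) (simp_all add: distrib_left scale_mult_right)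

lemma linear_mult_right: "Vector_Spaces.linear sH sH (\<lambda>h. h * x)"
  by (rule linearI[OF vH vH]) (simp_all add: distrib_right scale_mult_left)

lemma lf_mult_left: "lf f \<Longrightarrow> lf (\<lambda>h. f (x * h))"
  by (rule linear_compD[OF linear_mult_left])

lemma lf_mult_right: "lf f \<Longrightarrow> lf (\<lambda>h. f (h * x))"
  by (rule linear_compD[OF linear_mult_right])

lemma lf_counit: "lf counit"
  by (rule counit_linear)

text \<open>Equal contractions give literally equal expansions along \<open>B\<close>. Hence nothing
  is lost when a coaction is replaced by the action of functionals.\<close>

lemma tensor_eqI:
  fixes sV :: "'k \<Rightarrow> 'v::ab_group_add \<Rightarrow> 'v"
  assumes "vector_space sV" "\<And>f. lf f \<Longrightarrow> contract sV f p = contract sV f q"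
  shows "tensor_eq sH sV p q"
proof -
  note e = tensor_eq_expand[OF vH assms(1) finite_Basis independent_Basis span_Basis]
  have "(\<Sum>i\<in>B. pure (i, contract sV (\<lambda>x. representation B x i) p))
      = (\<Sum>i\<in>B. pure (i, contract sV (\<lambda>x. representation B x i) q) :: 'h \<times> 'v \<Rightarrow>\<^sub>0 'k)"
    using assms(2)[OF lf_coord] by (simp add: coord_def[abs_def])
  then have "tensor_eq sH sV p (\<Sum>i\<in>B. pure (i, contract sV (\<lambda>x. representation B x i) q))"
    using e[of p] by simp
  then show ?thesis
    by (rule tensor_eq_trans[OF _ tensor_eq_sym[OF e[of q]]])
qed

text \<open>In Sweedler notation \<open>lact f h = f(h\<^sub>1) h\<^sub>2\<close>, \<open>ract f h = h\<^sub>1 f(h\<^sub>2)\<close> and \<open>conv f f' h = f(h\<^sub>1) f'(h\<^sub>2)\<close>.\<close>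

definition lact :: "('h \<Rightarrow> 'k) \<Rightarrow> 'h \<Rightarrow> 'h" where "lact f h = contract sH f (comult h)"

definition ract :: "('h \<Rightarrow> 'k) \<Rightarrow> 'h \<Rightarrow> 'h"
  where "ract f h = free_lift sH (\<lambda>(x, y). sH (f y) x) (comult h)"

definition conv :: "('h \<Rightarrow> 'k) \<Rightarrow> ('h \<Rightarrow> 'k) \<Rightarrow> 'h \<Rightarrow> 'k" where "conv f f' h = f' (lact f h)"

lemma comult_linear: "tensor_linear sH sH sH comult"
  and comult_mult: "tensor_eq sH sH (comult (a * b)) (tensor_mult (comult a) (comult b))"
  and comult_one: "tensor_eq sH sH (comult 1) (pure (1, 1))"
  using comult_algebra_map unfolding tensor_algebra_map_def by auto

lemma lact_linear: "lf f \<Longrightarrow> Vector_Spaces.linear sH sH (lact f)"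
  unfolding lact_def[abs_def] by (rule contract_tensor_linear[OF vH vH vH _ comult_linear])

lemma lf_conv: "lf f \<Longrightarrow> lf f' \<Longrightarrow> lf (conv f f')"
  unfolding conv_def[abs_def] by (rule linear_compD[OF lact_linear])

lemma conv_eq:
  assumes "lf f'" shows "conv f f' h = free_lift (*) (\<lambda>(x, y). f x * f' y) (comult h)"
  unfolding conv_def lact_def contract_def linear_free_lift[OF assms]
  by (simp add: case_prod_unfold linear_scaleD[OF assms])

lemma lf_ract:
  assumes "lf f" "lf f'" shows "f (ract f' h) = conv f f' h"
  unfolding conv_eq[OF assms(2)] ract_def linear_free_lift[OF assms(1)]
  by (simp add: case_prod_unfold linear_scaleD[OF assms(1)] mult.commute)

lemma ract_linear:
  assumes "lf f" shows "Vector_Spaces.linear sH sH (ract f)"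
proof (rule linearI[OF vH vH]; rule lf_eqI)
  fix x y c f' assume f': "lf f'"
  note l = linear_addD[OF f'] linear_scaleD[OF f'] lf_ract[OF f' assms]
    linear_addD[OF lf_conv[OF f' assms]] linear_scaleD[OF lf_conv[OF f' assms]]
  show "f' (ract f (x + y)) = f' (ract f x + ract f y)" "f' (ract f (sH c x)) = f' (sH c (ract f x))"
    by (simp_all add: l)
qed

lemma linear_scale_left: "vector_space sV \<Longrightarrow> Vector_Spaces.linear (*) sV (\<lambda>c. sV c v)"
  by (rule linearI) (auto simp: vector_space_field vector_space.vector_space_assms)

text \<open>Coassociativity is evaluated on \<open>f'(x) f(y) w\<close>. The functional applied
  first meets the leftmost leg, so left comodules become right modules over the convolution
  algebra.\<close>

lemma contract_contract:
  fixes sV :: "'k \<Rightarrow> 'v::ab_group_add \<Rightarrow> 'v"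
  assumes vV: "vector_space sV" and d: "tensor_linear sV sH sV \<delta>"
    and f: "lf f" "lf f'" and co: "tensor3_eq sH sH sV (tensor_map_left comult p) (tensor_map_right \<delta> p)"
  shows "contract sV f (\<delta> (contract sV f' p)) = contract sV (conv f' f) p"
proof -
  interpret V: vector_space sV by fact
  let ?F = "\<lambda>x y w. sV (f' x * f y) w"
  have "free_lift sV (\<lambda>(v, w). free_lift sV (\<lambda>(x, y). ?F x y w) (comult v)) p
      = free_lift sV (\<lambda>(v, w). free_lift sV (\<lambda>(x, y). ?F v x y) (\<delta> w)) p"
  proof (rule coassoc_apply[OF vH vV vV _ _ _ co])
    fix v w x y
    show "Vector_Spaces.linear sH sV (\<lambda>x. ?F x y w)"
      by (rule linearI[OF vH vV]) (auto simp: linearD[OF f(2)] V.scale_left_distrib distrib_right)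
    show "Vector_Spaces.linear sH sV (\<lambda>y. ?F x y w)"
      by (rule linearI[OF vH vV]) (auto simp: linearD[OF f(1)] V.scale_left_distrib distrib_left mult.left_commute)
    show "Vector_Spaces.linear sV sV (\<lambda>w. ?F x y w)"
      by (rule linearI[OF vV vV]) (auto simp: V.scale_right_distrib mult.commute)
  qed
  also have "(\<lambda>(v, w). free_lift sV (\<lambda>(x, y). ?F x y w) (comult v)) = (\<lambda>(v, w). sV (conv f' f v) w)"
    unfolding conv_eq[OF f(1)] linear_free_lift[OF linear_scale_left[OF vV]]
    by (auto simp: case_prod_unfold)
  also have "(\<lambda>(v, w). free_lift sV (\<lambda>(x, y). ?F v x y) (\<delta> w)) = (\<lambda>(v, w). sV (f' v) (contract sV f (\<delta> w)))"
    unfolding contract_def free_lift_fun_scale[OF vV, symmetric]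
    by (auto simp: case_prod_unfold)
  finally have "contract sV (conv f' f) p = free_lift sV (\<lambda>(v, w). sV (f' v) (contract sV f (\<delta> w))) p"
    by (simp add: contract_def)
  also have "\<dots> = contract sV f (\<delta> (contract sV f' p))"
    unfolding contract_def[of sV f' p] linear_free_lift[OF contract_tensor_linear[OF vV vH vV f(1) d]]
    by (simp add: case_prod_unfold linear_scaleD[OF contract_tensor_linear[OF vV vH vV f(1) d]])
  finally show ?thesis ..
qed

lemma lact_lact: "lf f \<Longrightarrow> lf f' \<Longrightarrow> lact f (lact f' h) = lact (conv f' f) h"
  unfolding lact_def by (rule contract_contract[OF vH comult_linear _ _ coassoc])

lemma conv_assoc: "lf f \<Longrightarrow> lf f' \<Longrightarrow> lf f'' \<Longrightarrow> conv (conv f f') f'' h = conv f (conv f' f'') h"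
  using lact_lact by (simp add: conv_def[of _ f''] conv_def[of f "conv f' f''"])

lemma lact_counit: "lact counit h = h"
  using counit_left by (simp add: lact_def contract_def)

lemma ract_counit: "ract counit h = h"
  using counit_right by (simp add: ract_def)

lemma conv_counit_right: "lf f \<Longrightarrow> conv f counit h = f h"
  using lf_ract[OF _ lf_counit, of f h] by (simp add: ract_counit)

lemma counit_lact: "lf f \<Longrightarrow> counit (lact f h) = f h"
  using conv_counit_right by (simp add: conv_def)

text \<open>Both sides pair with \<open>f''\<close> to \<open>f(h_1) f''(h_2) f'(h_3)\<close>, by
  associativity of \<open>conv\<close>. As a consequence, right translates of left coideals are left
  coideals.\<close>

lemma lact_ract: "lf f \<Longrightarrow> lf f' \<Longrightarrow> lact f (ract f' h) = ract f' (lact f h)"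
proof (rule lf_eqI)
  fix f'' assume *: "lf f" "lf f'" "lf f''"
  have "f'' (lact f (ract f' h)) = conv (conv f f'') f' h"
    using * lf_ract[of "conv f f''" f'] by (simp add: lf_conv conv_def[of f f''])
  also have "\<dots> = conv f (conv f'' f') h" using * by (simp add: conv_assoc)
  also have "\<dots> = f'' (ract f' (lact f h))" using * by (simp add: lf_ract conv_def[of f "conv f'' f'"])
  finally show "f'' (lact f (ract f' h)) = f'' (ract f' (lact f h))" .
qed

lemma ract_ract: "lf f \<Longrightarrow> lf f' \<Longrightarrow> ract f (ract f' h) = ract (conv f f') h"
  by (rule lf_eqI) (simp add: lf_ract lf_conv conv_assoc)

lemma lact_mult: "lf f \<Longrightarrow> lact f (h * x) = free_lift sH (\<lambda>(y, x'). lact (\<lambda>h. f (h * y)) h * x') (comult x)"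
  unfolding lact_def by (rule contract_mult[OF vH kH _ comult_mult])

lemma lact_fun_add: "lact (\<lambda>h. f h + f' h) x = lact f x + lact f' x"
  and lact_fun_scale: "lact (\<lambda>h. c * f h) x = sH c (lact f x)"
  by (simp_all add: lact_def contract_fun_add[OF vH] contract_fun_scale[OF vH])

text \<open>The condition \<open>comult g = g \<otimes> g\<close> is tested by contractions, so that
  no representatives appear; \<open>comult_grouplike\<close> recovers the tensor form.\<close>

definition grouplike :: "'h \<Rightarrow> bool"
  where "grouplike g \<longleftrightarrow> counit g = 1 \<and> (\<forall>f. lf f \<longrightarrow> lact f g = sH (f g) g)"

lemma grouplikeD: "grouplike g \<Longrightarrow> counit g = 1" "grouplike g \<Longrightarrow> lf f \<Longrightarrow> lact f g = sH (f g) g"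
  by (auto simp: grouplike_def)

lemma grouplike_nonzero: "grouplike g \<Longrightarrow> g \<noteq> 0"
  using grouplikeD(1) linear_zeroD[OF lf_counit] by force

lemma ract_grouplike:
  assumes "grouplike g" "lf f" shows "ract f g = sH (f g) g"
proof (rule lf_eqI)
  fix f' assume "lf f'"
  then show "f' (ract f g) = f' (sH (f g) g)"
    using assms by (simp add: lf_ract conv_def grouplikeD linear_scaleD[of sH "(*)"])
qed

lemma comult_grouplike: "grouplike g \<Longrightarrow> tensor_eq sH sH (comult g) (pure (g, g))"
  by (rule tensor_eqI[OF vH]) (simp add: lact_def[symmetric] contract_pure[OF vH] grouplikeD)

lemma grouplike_one: "grouplike 1"
  unfolding grouplike_def
  using contract_cong[OF vH vH _ comult_one] by (simp add: lact_def contract_pure[OF vH] counit_one)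

text \<open>Contractions of \<open>g\<close> are multiples of \<open>g\<close>, so multiplication by
  \<open>g\<close> only translates the functional. The same twist reappears in
  \<open>cact_weight_space_mult\<close> and \<open>hom_act_hom_mult_weight\<close>.\<close>

lemma lact_grouplike_mult: "grouplike g \<Longrightarrow> lf f \<Longrightarrow> lact f (g * x) = g * lact (\<lambda>h. f (g * h)) x"
proof -
  assume g: "grouplike g" and f: "lf f"
  note lin = linear_mult_left[of g]
  have "lact f (g * x) = free_lift sH (\<lambda>z. g * (case z of (y, x') \<Rightarrow> sH (f (g * y)) x')) (comult x)"
    unfolding lact_mult[OF f]
    by (rule free_lift_cong)
       (auto simp: grouplikeD(2)[OF g lf_mult_right[OF f]] scale_mult_left scale_mult_right)
  then show ?thesis
    unfolding linear_free_lift[OF lin, symmetric] lact_def contract_def .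
qed

lemma grouplike_mult: "grouplike g \<Longrightarrow> grouplike h \<Longrightarrow> grouplike (g * h)"
  unfolding grouplike_def[of "g * h"]
  by (simp add: counit_mult grouplikeD(1) lact_grouplike_mult grouplikeD(2)[of h] lf_mult_left scale_mult_right)

text \<open>The antipode identities, evaluated on the representative \<open>g \<otimes> g\<close>,
  give the inverse. Translating functionals by that inverse then reduces grouplikeness of
  \<open>antipode g\<close> to that of \<open>g * antipode g = 1\<close>.\<close>

lemma grouplike_antipode:
  assumes g: "grouplike g"
  shows "antipode g * g = 1" "g * antipode g = 1" "grouplike (antipode g)"
proof -
  note S = antipode_linear
  show l: "antipode g * g = 1"
  proof -
    have "free_lift sH (\<lambda>(x, y). antipode x * y) (comult g) = free_lift sH (\<lambda>(x, y). antipode x * y) (pure (g, g))"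
      by (rule free_lift_tensor_cong[OF vH vH vH _ _ comult_grouplike[OF g]])
         (auto intro!: linearI vH simp: linearD[OF S] algebra_simps scale_mult_left scale_mult_right)
    then show ?thesis using antipode_left[of g] by (simp add: grouplikeD(1)[OF g])
  qed
  show r: "g * antipode g = 1"
  proof -
    have "free_lift sH (\<lambda>(x, y). x * antipode y) (comult g) = free_lift sH (\<lambda>(x, y). x * antipode y) (pure (g, g))"
      by (rule free_lift_tensor_cong[OF vH vH vH _ _ comult_grouplike[OF g]])
         (auto intro!: linearI vH simp: linearD[OF S] algebra_simps scale_mult_left scale_mult_right)
    then show ?thesis using antipode_right[of g] by (simp add: grouplikeD(1)[OF g])
  qed
  have "lact f (antipode g) = sH (f (antipode g)) (antipode g)" if f: "lf f" for f
  proof -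
    let ?f = "\<lambda>h. f (antipode g * h)"
    have f': "lf ?f" by (rule lf_mult_left[OF f])
    have "(\<lambda>h. ?f (g * h)) = f" by (simp add: mult.assoc[symmetric] l)
    then have "g * lact f (antipode g) = lact ?f (g * antipode g)"
      using lact_grouplike_mult[OF g f', of "antipode g"] by simp
    also have "\<dots> = sH (f (antipode g)) 1"
      unfolding r using grouplikeD(2)[OF grouplike_one f'] by simp
    finally have "antipode g * (g * lact f (antipode g)) = antipode g * sH (f (antipode g)) 1" by simp
    then show ?thesis by (simp add: mult.assoc[symmetric] l scale_mult_right)
  qed
  moreover have "counit (antipode g) = 1"
    using counit_mult[of g "antipode g"] by (simp add: r counit_one grouplikeD(1)[OF g])
  ultimately show "grouplike (antipode g)" by (simp add: grouplike_def)
qed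

text \<open>In tensor form, \<open>comult\<close> maps \<open>W\<close> into
  \<open>H \<otimes> W\<close>: these are the subcomodules of \<open>H\<close> under its left
  coaction.\<close>

definition left_coideal :: "'h set \<Rightarrow> bool"
  where "left_coideal W \<longleftrightarrow> subspace W \<and> (\<forall>f. lf f \<longrightarrow> (\<forall>w\<in>W. lact f w \<in> W))"

lemma left_coidealD: "left_coideal W \<Longrightarrow> subspace W" "left_coideal W \<Longrightarrow> lf f \<Longrightarrow> w \<in> W \<Longrightarrow> lact f w \<in> W"
  by (auto simp: left_coideal_def)

text \<open>Over a field \<open>H \<otimes> D\<close> and \<open>D \<otimes> H\<close> intersect in
  \<open>D \<otimes> D\<close>, and the two stability conditions say that the coproduct of
  \<open>D\<close> lies in each of them.\<close>

lemma subcoalgebra_iff: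
  "subcoalgebra sH comult D \<longleftrightarrow> left_coideal D \<and> (\<forall>f. lf f \<longrightarrow> (\<forall>d\<in>D. ract f d \<in> D))"
proof
  assume D: "subcoalgebra sH comult D"
  then have sub: "subspace D" by (simp add: subcoalgebra_def)
  have "lact f d \<in> D \<and> ract f d \<in> D" if f: "lf f" and d: "d \<in> D" for f d
  proof -
    from D d obtain q where q: "Poly_Mapping.keys q \<subseteq> D \<times> D" "tensor_eq sH sH (comult d) q"
      unfolding subcoalgebra_def tensor_sub_def by blast
    have "lact f d = contract sH f q"
      unfolding lact_def by (rule contract_cong[OF vH vH f q(2)])
    moreover have "contract sH f q \<in> D"
      unfolding contract_def by (rule free_lift_in_subspace[OF vH sub]) (use q(1) in \<open>auto intro!: subspace_scale[OF sub]\<close>)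
    moreover have "ract f d = free_lift sH (\<lambda>(x, y). sH (f y) x) q"
      unfolding ract_def
      by (rule free_lift_tensor_cong[OF vH vH vH _ _ q(2)])
         (simp_all add: Vector_Spaces.linear_iff vH linear_addD[OF f] linear_scaleD[OF f] scale_left_distrib scale_right_distrib mult.commute)
    moreover have "free_lift sH (\<lambda>(x, y). sH (f y) x) q \<in> D"
      by (rule free_lift_in_subspace[OF vH sub]) (use q(1) in \<open>auto intro!: subspace_scale[OF sub]\<close>)
    ultimately show ?thesis by simp
  qed
  with sub show "left_coideal D \<and> (\<forall>f. lf f \<longrightarrow> (\<forall>d\<in>D. ract f d \<in> D))"
    by (auto simp: left_coideal_def)
next
  assume D: "left_coideal D \<and> (\<forall>f. lf f \<longrightarrow> (\<forall>d\<in>D. ract f d \<in> D))"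
  then have sub: "subspace D" and l: "\<And>f d. lf f \<Longrightarrow> d \<in> D \<Longrightarrow> lact f d \<in> D"
    and r: "\<And>f d. lf f \<Longrightarrow> d \<in> D \<Longrightarrow> ract f d \<in> D"
    by (auto simp: left_coideal_def)
  obtain C where C: "C \<subseteq> D" "independent C" "D \<subseteq> span C"
    using maximal_independent_subset by blast
  obtain C' where C': "C \<subseteq> C'" "independent C'" "span C' = UNIV"
    using maximal_independent_subset_extend[OF subset_UNIV C(2)] by (metis top.extremum_uniqueI)
  have finC': "finite C'" by (rule finiteI_independent[OF C'(2)])
  define cf where "cf i = (\<lambda>x. representation C' x i)" for i
  have cf: "lf (cf i)" for i unfolding cf_def by (rule lf_representation[OF C'(2,3)])
  have "comult d \<in> tensor_sub sH sH D D" if d: "d \<in> D" for d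
  proof -
    \<comment> \<open>For \<open>i\<close> outside \<open>C\<close> the functional
      \<open>cf i\<close> vanishes on \<open>D\<close>, which contains \<open>ract f d\<close>; so
      basis vectors outside \<open>D\<close> get coefficient zero in the left leg.\<close>
    have zero: "lact (cf i) d = 0" if "i \<notin> C" for i
    proof (rule lf_eqI)
      fix f assume f: "lf f"
      have "representation C' (ract f d) = representation C (ract f d)"
        by (rule representation_extend[OF C'(2) _ C'(1)]) (rule subsetD[OF C(3) r[OF f d]])
      then have "cf i (ract f d) = 0"
        using representation_ne_zero[of C "ract f d" i] that by (metis cf_def)
      then show "f (lact (cf i) d) = f 0"
        using lf_ract[OF cf f, of i d] by (simp add: conv_def linear_zeroD[OF f])
    qed
    let ?p = "\<lambda>i. pure (i, lact (cf i) d) :: 'h \<times> 'h \<Rightarrow>\<^sub>0 'k"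
    let ?q = "\<Sum>i\<in>C. ?p i"
    have "(\<Sum>i\<in>C'. ?p i) = ?q + (\<Sum>i\<in>C' - C. ?p i)"
      using sum.subset_diff[OF C'(1) finC', of ?p] by (simp add: add.commute)
    moreover have "tensor_eq sH sH (comult d) (\<Sum>i\<in>C'. ?p i)"
      using tensor_eq_expand[OF vH vH finC' C'(2,3), of "comult d"] unfolding lact_def cf_def .
    ultimately have "tensor_eq sH sH (comult d) (?q + (\<Sum>i\<in>C' - C. ?p i))" by simp
    moreover have "tensor_eq sH sH (?q + (\<Sum>i\<in>C' - C. ?p i)) (?q + (\<Sum>i\<in>C' - C. 0))"
    proof (rule tensor_eq_add[OF tensor_eq_refl tensor_eq_sum])
      fix i assume "i \<in> C' - C"
      then have "lact (cf i) d = 0" by (simp add: zero)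
      then show "tensor_eq sH sH (?p i) 0"
        using tensor_eq_pure_zero_right[OF vH] by simp
    qed
    ultimately have "tensor_eq sH sH (comult d) (?q + (\<Sum>i\<in>C' - C. 0))"
      by (rule tensor_eq_trans)
    then have "tensor_eq sH sH (comult d) ?q" by simp
    moreover have "Poly_Mapping.keys ?q \<subseteq> D \<times> D"
    proof -
      have "Poly_Mapping.keys ?q \<subseteq> (\<Union>i\<in>C. Poly_Mapping.keys (?p i))" by (rule keys_sum)
      also have "\<dots> \<subseteq> D \<times> D" using C(1) l[OF cf d] by (auto simp: pure_def)
      finally show ?thesis .
    qed
    ultimately show ?thesis unfolding tensor_sub_def by (intro CollectI exI[of _ ?q] conjI)
  qed
  with sub show "subcoalgebra sH comult D" by (simp add: subcoalgebra_def)
qed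

text \<open>A nonzero subcoalgebra of least dimension inside \<open>C\<close> is simple, hence a
  line because \<open>H\<close> is pointed. Its generator becomes grouplike after division by its
  counit.\<close>

lemma ex_grouplike:
  assumes C: "subcoalgebra sH comult C" "C \<noteq> {0}"
  shows "\<exists>g\<in>C. grouplike g"
proof -
  let ?P = "\<lambda>D. subcoalgebra sH comult D \<and> D \<noteq> {0} \<and> D \<subseteq> C"
  obtain D where D: "?P D" and min: "\<And>D'. ?P D' \<Longrightarrow> dim D \<le> dim D'"
    using ex_has_least_nat[of ?P C dim] C by auto
  have "D' = {0} \<or> D' = D" if D': "subcoalgebra sH comult D'" "D' \<subseteq> D" for D'
  proof (cases "D' = {0}")
    case False
    then have "dim D \<le> dim D'" using min[of D'] D' D by auto
    then show ?thesis
      using subspace_dim_equal[of D' D] D D' by (simp add: subcoalgebra_def)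
  qed simp
  with D have "simple_subcoalgebra sH comult D"
    by (simp add: simple_subcoalgebra_def)
  then have "dim D = 1" using pointed by (simp add: pointed_def)
  then obtain S where S: "S \<subseteq> D" "independent S" "D \<subseteq> span S" "card S = 1"
    using basis_exists[of D] by auto
  then obtain d where d: "S = {d}" by (auto simp: card_1_singleton_iff)
  have d0: "d \<noteq> 0" and dD: "d \<in> D" and span: "D \<subseteq> range (\<lambda>a. sH a d)"
    using S unfolding d by (auto simp: span_singleton)
  have lactD: "lact f d \<in> D" if "lf f" for f
    using D that dD unfolding subcoalgebra_iff by (auto simp: left_coideal_def)
  have fd: "\<exists>a. lact f d = sH a d \<and> f d = a * counit d" if f: "lf f" for f
  proof -
    obtain a where a: "lact f d = sH a d" using lactD[OF f] span by blast
    have "f d = a * counit d"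
      using counit_lact[OF f, of d] by (simp add: a linear_scaleD[OF lf_counit])
    with a show ?thesis by blast
  qed
  \<comment> \<open>Otherwise the counit axiom would make every functional vanish on
    \<open>d\<close>.\<close>
  have e: "counit d \<noteq> 0"
  proof
    assume "counit d = 0"
    then have "f d = f 0" if "lf f" for f using fd[OF that] linear_zeroD[OF that] by auto
    then show False using lf_eqI d0 by blast
  qed
  let ?g = "sH (inverse (counit d)) d"
  have "grouplike ?g"
    unfolding grouplike_def
  proof (intro conjI allI impI)
    show "counit ?g = 1" using e by (simp add: linear_scaleD[OF lf_counit])
    fix f assume f: "lf f"
    then show "lact f ?g = sH (f ?g) ?g"
      using fd[OF f] e by (auto simp: linear_scaleD[OF lact_linear[OF f]] linear_scaleD[OF f])
  qed
  moreover have "?g \<in> C"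
    using D dD subspace_scale[of D] by (auto simp: subcoalgebra_def)
  ultimately show ?thesis by blast
qed

text \<open>A minimal left coideal \<open>W\<close> is one-dimensional: some grouplike \<open>g\<close> lies in the coefficient
  coalgebra of \<open>W\<close>, and comparing a right translate of \<open>W\<close> with a left coideal that is maximal
  without containing \<open>g\<close> shows that the translate contains a vector of weight \<open>g\<close>.\<close>

lemma minimal_left_coideal_weight_vector:
  assumes W: "left_coideal W" "W \<noteq> {0}"
    and minimal: "\<And>W'. left_coideal W' \<Longrightarrow> W' \<subseteq> W \<Longrightarrow> W' = {0} \<or> W' = W"
  shows "\<exists>w\<in>W. w \<noteq> 0 \<and> (\<exists>g. grouplike g \<and> (\<forall>f. lf f \<longrightarrow> lact f w = sH (f g) w))"
proof -
  define C where "C = span (\<Union>f\<in>Collect lf. ract f ` W)"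
  have "subcoalgebra sH comult C"
    unfolding subcoalgebra_iff left_coideal_def
  proof (intro conjI allI impI ballI)
    show "subspace C" by (simp add: C_def)
    fix f c assume f: "lf f" and c: "c \<in> C"
    have "C \<subseteq> {c. lact f c \<in> C}" unfolding C_def
    proof (rule span_minimal, safe)
      fix f' w assume *: "lf f'" "w \<in> W"
      show "lact f (ract f' w) \<in> span (\<Union>f\<in>Collect lf. ract f ` W)"
        unfolding lact_ract[OF f *(1)] using left_coidealD(2)[OF W(1) f *(2)] *(1) by (auto intro: span_base)
    next
      interpret l: Vector_Spaces.linear sH sH "lact f" by (rule lact_linear[OF f])
      show "subspace {c. lact f c \<in> span (\<Union>f\<in>Collect lf. ract f ` W)}"
        by (rule l.subspace_linear_preimage) simp
    qed
    with c show "lact f c \<in> C" by auto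
    have "C \<subseteq> {c. ract f c \<in> C}" unfolding C_def
    proof (rule span_minimal, safe)
      fix f' w assume *: "lf f'" "w \<in> W"
      show "ract f (ract f' w) \<in> span (\<Union>f\<in>Collect lf. ract f ` W)"
        unfolding ract_ract[OF f *(1)] using * lf_conv[OF f *(1)] by (auto intro: span_base)
    next
      interpret l: Vector_Spaces.linear sH sH "ract f" by (rule ract_linear[OF f])
      show "subspace {c. ract f c \<in> span (\<Union>f\<in>Collect lf. ract f ` W)}"
        by (rule l.subspace_linear_preimage) simp
    qed
    with c show "ract f c \<in> C" by auto
  qed
  moreover have "C \<noteq> {0}"
  proof -
    obtain w where w: "w \<in> W" "w \<noteq> 0" using W left_coidealD(1) subspace_0 by blast
    then have "ract counit w \<in> C" unfolding C_def using lf_counit by (blast intro: span_base)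
    then show ?thesis using w by (auto simp: ract_counit)
  qed
  ultimately obtain g where g: "g \<in> C" "grouplike g" using ex_grouplike by blast
  let ?P = "\<lambda>X. left_coideal X \<and> g \<notin> X"
  have "?P {0}"
    using grouplike_nonzero[OF g(2)] by (auto simp: left_coideal_def linear_zeroD[OF lact_linear])
  moreover have "\<forall>y. ?P y \<longrightarrow> dim y < Suc dimension"
    using dim_subset_UNIV by (simp add: less_Suc_eq_le)
  ultimately obtain X where X: "left_coideal X" "g \<notin> X" and max: "\<And>Y. ?P Y \<Longrightarrow> dim Y \<le> dim X"
    using ex_has_greatest_nat[of ?P "{0}" dim "Suc dimension"] by (auto simp: less_Suc_eq_le)
  note Xs = left_coidealD(1)[OF X(1)]
  \<comment> \<open>\<open>C\<close> is spanned by the right translates of \<open>W\<close> and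
    contains \<open>g\<close>, so some translate is not inside \<open>X\<close>.\<close>
  obtain f w0 where f: "lf f" and w0: "w0 \<in> W" "ract f w0 \<notin> X"
  proof -
    have "\<not> (\<Union>f\<in>Collect lf. ract f ` W) \<subseteq> X"
      using span_minimal[OF _ Xs] g(1) X(2) unfolding C_def by blast
    then show ?thesis using that by blast
  qed
  interpret r: Vector_Spaces.linear sH sH "ract f" by (rule ract_linear[OF f])
  \<comment> \<open>The vectors of \<open>W\<close> whose translate falls into \<open>X\<close> form
    a left coideal that misses \<open>w0\<close>; minimality of \<open>W\<close> makes it
    zero.\<close>
  have zero: "z = 0" if "z \<in> W" "ract f z \<in> X" for z
  proof -
    have "left_coideal {w \<in> W. ract f w \<in> X}"
      unfolding left_coideal_def
    proof (intro conjI allI impI ballI)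
      show "subspace {w \<in> W. ract f w \<in> X}"
        using subspace_inter[OF left_coidealD(1)[OF W(1)] r.subspace_linear_preimage[OF Xs]]
        by (simp add: Int_def)
      fix f' w assume "lf f'" "w \<in> {w \<in> W. ract f w \<in> X}"
      then show "lact f' w \<in> {w \<in> W. ract f w \<in> X}"
        using left_coidealD(2)[OF W(1)] left_coidealD(2)[OF X(1)] by (auto simp: lact_ract[OF _ f, symmetric])
    qed
    from minimal[OF this] w0 that show ?thesis by blast
  qed
  let ?Y = "{x + y | x y. x \<in> X \<and> y \<in> ract f ` W}"
  have Y: "left_coideal ?Y"
    unfolding left_coideal_def
  proof (intro conjI allI impI ballI)
    show "subspace ?Y"
      by (rule subspace_sums[OF Xs r.subspace_image[OF left_coidealD(1)[OF W(1)]]])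
    fix f' y assume f': "lf f'" and "y \<in> ?Y"
    then obtain x w where "x \<in> X" "w \<in> W" "y = x + ract f w" by blast
    then have "lact f' y = lact f' x + ract f (lact f' w)" "lact f' x \<in> X" "lact f' w \<in> W"
      using left_coidealD(2)[OF W(1) f'] left_coidealD(2)[OF X(1) f']
      by (auto simp: linear_addD[OF lact_linear[OF f']] lact_ract[OF f' f])
    then show "lact f' y \<in> ?Y" by blast
  qed
  have XY: "X \<subseteq> ?Y" and w0Y: "ract f w0 \<in> ?Y"
  proof -
    have "0 \<in> ract f ` W" using left_coidealD(1)[OF W(1)] subspace_0 imageI[of 0 W "ract f"] by (simp add: r.zero)
    then show "X \<subseteq> ?Y" by force
    show "ract f w0 \<in> ?Y" using w0(1) subspace_0[OF Xs] by force
  qed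
  \<comment> \<open>\<open>?Y\<close> is strictly larger than \<open>X\<close>, so by the maximality
    of \<open>X\<close> it cannot avoid \<open>g\<close>.\<close>
  have "g \<in> ?Y"
    using max[of ?Y] Y subspace_dim_equal[OF Xs left_coidealD(1)[OF Y] XY] w0Y w0(2) by auto
  then obtain x w where x: "x \<in> X" and w: "w \<in> W" and gxw: "g = x + ract f w" by blast
  have "w \<noteq> 0" using gxw x X(2) by auto
  \<comment> \<open>Modulo \<open>X\<close> the translate of \<open>w\<close> is \<open>g\<close>,
    so the deviation of \<open>w\<close> from weight \<open>g\<close> is translated into
    \<open>X\<close> and therefore vanishes.\<close>
  moreover have "lact f' w = sH (f' g) w" if f': "lf f'" for f'
  proof -
    have rw: "ract f w = g - x" using gxw by simp
    have "ract f (lact f' w - sH (f' g) w) = lact f' (ract f w) - sH (f' g) (ract f w)"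
      by (simp add: r.diff r.scale lact_ract[OF f' f])
    also have "\<dots> = sH (f' g) x - lact f' x"
      unfolding rw by (simp add: linear_diffD[OF lact_linear[OF f']] grouplikeD(2)[OF g(2) f'] scale_right_diff_distrib)
    finally have "ract f (lact f' w - sH (f' g) w) \<in> X"
      using subspace_diff[OF Xs subspace_scale[OF Xs x] left_coidealD(2)[OF X(1) f' x]] by simp
    moreover have "lact f' w - sH (f' g) w \<in> W"
      using left_coidealD[OF W(1)] f' w by (auto intro: subspace_diff subspace_scale)
    ultimately show ?thesis using zero by fastforce
  qed
  ultimately show ?thesis using w g(2) by blast
qed

end

section \<open>Modules over the dual of a pointed Hopf algebra\<close>

text \<open>A right module over the convolution algebra, whence the order in \<open>act_act\<close>;
  as \<open>H\<close> is finite-dimensional, this amounts to a left comodule. The instances are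
  \<open>A\<close>, the functions from \<open>A\<close> to \<open>H\<close>, and \<open>H\<close>
  itself.\<close>

locale dual_module = H: pointed_hopf_algebra sH comult counit antipode B + V: vector_space sV
  for sH :: "'k::field \<Rightarrow> 'h::ring_1 \<Rightarrow> 'h"
    and comult :: "'h \<Rightarrow> ('h \<times> 'h \<Rightarrow>\<^sub>0 'k)"
    and counit :: "'h \<Rightarrow> 'k"
    and antipode :: "'h \<Rightarrow> 'h"
    and B :: "'h set"
    and sV :: "'k \<Rightarrow> 'v::ab_group_add \<Rightarrow> 'v" +
  fixes act :: "('h \<Rightarrow> 'k) \<Rightarrow> 'v \<Rightarrow> 'v"
  assumes act_linear: "H.lf f \<Longrightarrow> Vector_Spaces.linear sV sV (act f)"
    and act_fun_add: "H.lf f \<Longrightarrow> H.lf f' \<Longrightarrow> act (\<lambda>h. f h + f' h) v = act f v + act f' v"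
    and act_fun_scale: "H.lf f \<Longrightarrow> act (\<lambda>h. c * f h) v = sV c (act f v)"
    and act_counit: "act counit v = v"
    and act_act: "H.lf f \<Longrightarrow> H.lf f' \<Longrightarrow> act f (act f' v) = act (H.conv f' f) v"
begin

lemma vV: "vector_space sV"
  by unfold_locales

lemmas act_add = linear_addD[OF act_linear]
  and act_scale = linear_scaleD[OF act_linear]
  and act_diff = linear_diffD[OF act_linear]
  and act_zero = linear_zeroD[OF act_linear]

section \<open>Submodules, weights and coefficient maps\<close>

definition stable :: "'v set \<Rightarrow> bool"
  where "stable X \<longleftrightarrow> V.subspace X \<and> (\<forall>f. H.lf f \<longrightarrow> (\<forall>x\<in>X. act f x \<in> X))"

text \<open>A vector of weight \<open>g\<close> in the quotient by \<open>X\<close>, expressed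
  without the quotient. If \<open>X\<close> is stable, its own vectors satisfy this for every
  \<open>g\<close>, so \<open>v \<notin> X\<close> has to be demanded separately.\<close>

definition weight_mod :: "'v set \<Rightarrow> 'h \<Rightarrow> 'v \<Rightarrow> bool"
  where "weight_mod X g v \<longleftrightarrow> (\<forall>f. H.lf f \<longrightarrow> act f v - sV (f g) v \<in> X)"

lemma stableI:
  "V.subspace X \<Longrightarrow> (\<And>f x. H.lf f \<Longrightarrow> x \<in> X \<Longrightarrow> act f x \<in> X) \<Longrightarrow> stable X"
  by (simp add: stable_def)

lemma
  shows stable_subspace: "stable X \<Longrightarrow> V.subspace X"
    and stable_act: "stable X \<Longrightarrow> H.lf f \<Longrightarrow> x \<in> X \<Longrightarrow> act f x \<in> X"
  by (auto simp: stable_def)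

lemma stable_zero: "stable {0}"
  by (simp add: stable_def act_zero)

lemma lf_sum_coord: "H.lf (\<lambda>h. \<Sum>i\<in>S. u i * H.coord i h)"
  by (rule linearI[OF H.vH H.vK])
     (simp_all add: linear_addD[OF H.lf_coord] linear_scaleD[OF H.lf_coord] distrib_left sum.distrib
       sum_distrib_left mult.left_commute)

lemma act_fun_zero: "act (\<lambda>h. 0) v = 0"
  using act_fun_scale[OF H.lf_counit, of 0 v] by simp

lemma act_sum_coord: "act (\<lambda>h. \<Sum>i\<in>S. u i * H.coord i h) v = (\<Sum>i\<in>S. sV (u i) (act (H.coord i) v))"
proof (induction S rule: infinite_finite_induct)
  case (insert x S)
  have "H.lf (\<lambda>h. u x * H.coord x h)"
    using lf_sum_coord[of u "{x}"] by simp
  then have "act (\<lambda>h. u x * H.coord x h + (\<Sum>i\<in>S. u i * H.coord i h)) v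
      = act (\<lambda>h. u x * H.coord x h) v + act (\<lambda>h. \<Sum>i\<in>S. u i * H.coord i h) v"
    by (rule act_fun_add[OF _ lf_sum_coord])
  with insert show ?case by (simp add: act_fun_scale[OF H.lf_coord])
qed (simp_all add: act_fun_zero)

lemma act_expand:
  assumes "H.lf f" shows "act f v = (\<Sum>i\<in>B. sV (f i) (act (H.coord i) v))"
proof -
  have "f = (\<lambda>h. \<Sum>i\<in>B. f i * H.coord i h)"
    by (rule ext) (rule H.lf_expand[OF assms])
  then have "act f v = act (\<lambda>h. \<Sum>i\<in>B. f i * H.coord i h) v"
    by (rule arg_cong[of _ _ "\<lambda>f. act f v"])
  also have "\<dots> = (\<Sum>i\<in>B. sV (f i) (act (H.coord i) v))" by (rule act_sum_coord)
  finally show ?thesis .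
qed

text \<open>The comodule map \<open>v \<mapsto> v_{-1} l(v_0)\<close> that corresponds to
  \<open>l\<close> because \<open>H\<close> is the cofree comodule on the ground field;
  \<open>lf_coef\<close> characterises it.\<close>

definition coef :: "('v \<Rightarrow> 'k) \<Rightarrow> 'v \<Rightarrow> 'h"
  where "coef l v = (\<Sum>i\<in>B. sH (l (act (H.coord i) v)) i)"

lemma lf_coef:
  assumes "Vector_Spaces.linear sV (*) l" "H.lf f"
  shows "f (coef l v) = l (act f v)"
  unfolding coef_def act_expand[OF assms(2)]
  by (simp add: linear_sumD[OF assms(1)] linear_scaleD[OF assms(1)] linear_sumD[OF assms(2)]
      linear_scaleD[OF assms(2)] mult.commute)

lemma coef_linear:
  assumes l: "Vector_Spaces.linear sV (*) l"
  shows "Vector_Spaces.linear sV sH (coef l)"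
proof (rule linearI[OF vV H.vH]; rule H.lf_eqI)
  fix x y c f assume f: "H.lf f"
  show "f (coef l (x + y)) = f (coef l x + coef l y)" "f (coef l (sV c x)) = f (sH c (coef l x))"
    by (simp_all add: lf_coef[OF l f] linear_addD[OF f] linear_scaleD[OF f] act_add[OF f] act_scale[OF f]
        linear_addD[OF l] linear_scaleD[OF l])
qed

lemma lact_coef:
  assumes l: "Vector_Spaces.linear sV (*) l" and f: "H.lf f"
  shows "H.lact f (coef l v) = coef l (act f v)"
proof (rule H.lf_eqI)
  fix f' assume f': "H.lf f'"
  have "f' (H.lact f (coef l v)) = H.conv f f' (coef l v)" by (simp add: H.conv_def)
  also have "\<dots> = l (act (H.conv f f') v)" by (rule lf_coef[OF l H.lf_conv[OF f f']])
  also have "\<dots> = f' (coef l (act f v))" by (simp add: lf_coef[OF l f'] act_act[OF f' f])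
  finally show "f' (H.lact f (coef l v)) = f' (coef l (act f v))" .
qed

lemma counit_coef: "Vector_Spaces.linear sV (*) l \<Longrightarrow> counit (coef l v) = l v"
  by (simp add: lf_coef H.lf_counit act_counit)

text \<open>The functionals on \<open>H\<close> take at \<open>coef l v\<close> the values of
  \<open>l\<close> on the submodule generated by \<open>v\<close>, which stays inside
  \<open>X\<close>.\<close>

lemma coef_eq_0:
  assumes l: "Vector_Spaces.linear sV (*) l" and X: "stable X" "\<And>x. x \<in> X \<Longrightarrow> l x = 0" and v: "v \<in> X"
  shows "coef l v = 0"
proof (rule H.lf_eqI)
  fix f assume f: "H.lf f"
  show "f (coef l v) = f 0"
    using X(2)[OF stable_act[OF X(1) f v]] by (simp add: lf_coef[OF l f] linear_zeroD[OF f])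
qed

text \<open>The argument for eigenvectors: acting by \<open>f\<close> and subtracting the multiple
  by \<open>f g0\<close> removes the term of weight \<open>g0\<close> modulo \<open>Z\<close>, and
  functionals separate the other weights from \<open>g0\<close>.\<close>

lemma weights_independent:
  assumes Z: "stable Z" and L: "\<And>g. g \<in> I \<Longrightarrow> L g \<notin> Z" "\<And>g. g \<in> I \<Longrightarrow> weight_mod Z g (L g)"
    and S: "finite S" "S \<subseteq> I" and sum: "(\<Sum>g\<in>S. sV (u g) (L g)) \<in> Z" and g: "g \<in> S"
  shows "u g = 0"
  using S sum g
proof (induction S arbitrary: u g rule: finite_induct)
  case (insert g0 S)
  note Zs = stable_subspace[OF Z]
  let ?v = "\<Sum>g\<in>insert g0 S. sV (u g) (L g)"
  have key: "u g * (f g - f g0) = 0" if f: "H.lf f" and gS: "g \<in> S" for f g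
  proof -
    have "act f ?v - sV (f g0) ?v = (\<Sum>g\<in>insert g0 S. sV (u g) (act f (L g) - sV (f g0) (L g)))"
      by (simp only: linear_sumD[OF act_linear[OF f]] act_scale[OF f] V.scale_sum_right sum_subtractf[symmetric]
          V.scale_right_diff_distrib V.scale_scale mult.commute)
    also have "\<dots> = (\<Sum>g\<in>insert g0 S. sV (u g) (act f (L g) - sV (f g) (L g)))
        + (\<Sum>g\<in>insert g0 S. sV (u g * (f g - f g0)) (L g))"
      unfolding sum.distrib[symmetric]
      by (intro sum.cong refl) (simp add: V.scale_right_diff_distrib V.scale_left_diff_distrib right_diff_distrib)
    also have "(\<Sum>g\<in>insert g0 S. sV (u g * (f g - f g0)) (L g)) = (\<Sum>g\<in>S. sV (u g * (f g - f g0)) (L g))"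
      using insert.hyps by simp
    finally have eq: "(\<Sum>g\<in>S. sV (u g * (f g - f g0)) (L g))
        = (act f ?v - sV (f g0) ?v) - (\<Sum>g\<in>insert g0 S. sV (u g) (act f (L g) - sV (f g) (L g)))"
      by simp
    have "act f ?v - sV (f g0) ?v \<in> Z"
      using insert.prems(2) by (intro V.subspace_diff[OF Zs] stable_act[OF Z f] V.subspace_scale[OF Zs])
    moreover have "(\<Sum>g\<in>insert g0 S. sV (u g) (act f (L g) - sV (f g) (L g))) \<in> Z"
      using insert.prems(1) L(2) f
      by (intro V.subspace_sum[OF Zs] V.subspace_scale[OF Zs]) (auto simp: weight_mod_def)
    ultimately have "(\<Sum>g\<in>S. sV (u g * (f g - f g0)) (L g)) \<in> Z"
      unfolding eq by (rule V.subspace_diff[OF Zs])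
    then show ?thesis using insert.IH[of "\<lambda>g. u g * (f g - f g0)" g] insert.prems(1) gS by simp
  qed
  have S0: "u g = 0" if "g \<in> S" for g
  proof (rule ccontr)
    assume "u g \<noteq> 0"
    then have "f g = f g0" if "H.lf f" for f using key[OF that \<open>g \<in> S\<close>] by simp
    then have "g = g0" by (rule H.lf_eqI)
    with \<open>g \<in> S\<close> insert.hyps show False by simp
  qed
  then have "?v = sV (u g0) (L g0)" using insert.hyps by simp
  then have "sV (u g0) (L g0) \<in> Z" using insert.prems(2) by simp
  then have "u g0 = 0"
    using V.subspace_scale[OF Zs, of "sV (u g0) (L g0)" "inverse (u g0)"] L(1)[of g0] insert.prems(1)
    by (cases "u g0 = 0") auto
  with S0 insert.prems(3) show ?case by auto
qed simp

lemma ex_weight_functional: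
  assumes Z: "stable Z" and L: "\<And>g. g \<in> I \<Longrightarrow> L g \<notin> Z" "\<And>g. g \<in> I \<Longrightarrow> weight_mod Z g (L g)"
  shows "\<exists>l. Vector_Spaces.linear sV (*) l \<and> (\<forall>z\<in>Z. l z = 0) \<and> (\<forall>g\<in>I. l (L g) = c g)"
  by (rule ex_functional_mod[OF vV stable_subspace[OF Z]]) (rule weights_independent[OF Z L])

text \<open>The submodule generated by \<open>y\<close>. By \<open>cyc_span\<close> it is
  finite-dimensional whatever the ambient space, since the coordinate functionals suffice.\<close>

definition cyc :: "'v \<Rightarrow> 'v set" where "cyc y = {act f y | f. H.lf f}"

lemma cyc_span: "cyc y \<subseteq> V.span ((\<lambda>i. act (H.coord i) y) ` B)"
proof
  fix v assume "v \<in> cyc y"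
  then obtain f where "H.lf f" "v = act f y" by (auto simp: cyc_def)
  then have "v = (\<Sum>i\<in>B. sV (f i) (act (H.coord i) y))" by (simp only: act_expand)
  then show "v \<in> V.span ((\<lambda>i. act (H.coord i) y) ` B)"
    by (auto intro: V.span_sum V.span_scale V.span_base)
qed

lemma in_cyc: "y \<in> cyc y"
  unfolding cyc_def by (intro CollectI exI[of _ counit]) (simp add: H.lf_counit act_counit)

lemma stable_cyc: "stable (cyc y)"
proof (rule stableI)
  show "V.subspace (cyc y)"
  proof (rule V.subspaceI)
    show "0 \<in> cyc y"
      unfolding cyc_def using lf_sum_coord[of _ "{}"]
      by (intro CollectI exI[of _ "\<lambda>h. 0"]) (simp add: act_fun_zero)
    fix v w c assume "v \<in> cyc y" "w \<in> cyc y"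
    then obtain f f' where ff: "H.lf f" "H.lf f'" "v = act f y" "w = act f' y" by (auto simp: cyc_def)
    have "H.lf (\<lambda>h. f h + f' h)" "H.lf (\<lambda>h. c * f h)"
      using ff(1,2) by (auto simp: Vector_Spaces.linear_iff algebra_simps)
    with ff show "v + w \<in> cyc y" "sV c v \<in> cyc y"
      unfolding cyc_def by (auto simp: act_fun_add[symmetric] act_fun_scale[symmetric])
  qed
  fix f v assume f: "H.lf f" and "v \<in> cyc y"
  then obtain f' where "H.lf f'" "v = act f' y" by (auto simp: cyc_def)
  with f show "act f v \<in> cyc y" unfolding cyc_def using act_act H.lf_conv by auto
qed

lemma cyc_subset: "stable X \<Longrightarrow> y \<in> X \<Longrightarrow> cyc y \<subseteq> X"
  by (auto simp: cyc_def stable_act)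

text \<open>A cyclic submodule of least dimension among those generated outside \<open>X\<close> is
  simple modulo \<open>X\<close>. A coefficient map vanishing on \<open>X\<close> carries it onto a
  minimal left coideal of \<open>H\<close>, and the weight vector found there is lifted
  back.\<close>

lemma ex_weight_vector:
  assumes X: "stable X" and Y: "stable Y" and XY: "X \<subset> Y"
  obtains v g where "v \<in> Y" "v \<notin> X" "H.grouplike g" "weight_mod X g v"
proof -
  obtain y0 where "y0 \<in> Y \<and> y0 \<notin> X" using XY by blast
  then obtain y where y: "y \<in> Y \<and> y \<notin> X"
    and min: "\<And>z. z \<in> Y \<and> z \<notin> X \<Longrightarrow> V.dim (cyc y) \<le> V.dim (cyc z)"
    using ex_has_least_nat[of "\<lambda>z. z \<in> Y \<and> z \<notin> X" y0 "\<lambda>z. V.dim (cyc z)"] by blast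
  note Xs = stable_subspace[OF X]
  have cycY: "cyc y \<subseteq> Y" using cyc_subset[OF Y] y by blast
  \<comment> \<open>By the choice of \<open>y\<close>, a vector of \<open>cyc y\<close> outside
    \<open>X\<close> cannot generate a smaller submodule.\<close>
  have cyc_eq: "cyc z = cyc y" if z: "z \<in> cyc y" "z \<notin> X" for z
  proof (rule V.subspace_eqI_dim)
    show "V.subspace (cyc z)" "V.subspace (cyc y)" by (rule stable_subspace[OF stable_cyc])+
    show "cyc z \<subseteq> cyc y" by (rule cyc_subset[OF stable_cyc z(1)])
    show "cyc y \<subseteq> V.span ((\<lambda>i. act (H.coord i) y) ` B)" by (rule cyc_span)
    show "V.dim (cyc y) \<le> V.dim (cyc z)" using min z cycY by blast
  qed (simp add: H.finite_Basis)
  obtain l where l: "Vector_Spaces.linear sV (*) l" and lX: "\<And>x. x \<in> X \<Longrightarrow> l x = 0" and ly: "l y = 1"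
  proof -
    have "u i = 0" if S: "S \<subseteq> {y}" "(\<Sum>i\<in>S. sV (u i) i) \<in> X" "i \<in> S" for S u i
    proof (rule ccontr)
      assume u: "u i \<noteq> 0"
      from S have "S = {y}" "i = y" by auto
      with S(2) have "sV (u y) y \<in> X" by simp
      then have "sV (inverse (u y)) (sV (u y) y) \<in> X" by (rule V.subspace_scale[OF Xs])
      with u y \<open>i = y\<close> show False by simp
    qed
    then have "\<exists>l. Vector_Spaces.linear sV (*) l \<and> (\<forall>z\<in>X. l z = 0) \<and> (\<forall>i\<in>{y}. l i = 1)"
      by (intro ex_functional_mod[OF vV Xs])
    then show ?thesis using that by blast
  qed
  note coef0 = coef_eq_0[OF l X lX]
  let ?W = "coef l ` cyc y"
  interpret c: Vector_Spaces.linear sV sH "coef l" by (rule coef_linear[OF l])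
  have y0: "coef l y \<noteq> 0" using counit_coef[OF l, of y] ly linear_zeroD[OF H.lf_counit] by auto
  have W: "H.left_coideal ?W"
    unfolding H.left_coideal_def
    using c.subspace_image[OF stable_subspace[OF stable_cyc]] stable_act[OF stable_cyc]
    by (auto simp: lact_coef[OF l])
  have W0: "?W \<noteq> {0}" using y0 imageI[OF in_cyc[of y], of "coef l"] by auto
  have minW: "W' = {0} \<or> W' = ?W" if W': "H.left_coideal W'" "W' \<subseteq> ?W" for W'
  proof (cases "W' = {0}")
    case False
    then obtain w where w: "w \<in> W'" "w \<noteq> 0" using H.subspace_0[OF H.left_coidealD(1)[OF W'(1)]] by blast
    then obtain z where z: "z \<in> cyc y" "w = coef l z" using W'(2) by blast
    with w coef0 have "z \<notin> X" by blast
    then have "cyc y = cyc z" using cyc_eq z by simp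
    then have "?W \<subseteq> W'"
      using H.left_coidealD(2)[OF W'(1) _ w(1)] z(2) by (auto simp: cyc_def[of z] lact_coef[OF l, symmetric])
    with W' show ?thesis by blast
  qed simp
  obtain w g where w: "w \<in> ?W" "w \<noteq> 0" and g: "H.grouplike g" "\<And>f. H.lf f \<Longrightarrow> H.lact f w = sH (f g) w"
    using H.minimal_left_coideal_weight_vector[OF W W0 minW] by blast
  then obtain z where z: "z \<in> cyc y" "w = coef l z" by blast
  \<comment> \<open>A deviation outside \<open>X\<close> would generate \<open>y\<close>; but
    \<open>coef l\<close> kills the deviation, because \<open>w\<close> has weight \<open>g\<close>,
    and does not kill \<open>y\<close>.\<close>
  have "weight_mod X g z"
    unfolding weight_mod_def
  proof (intro allI impI, rule ccontr)
    fix f assume f: "H.lf f"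
    let ?v = "act f z - sV (f g) z"
    assume v: "?v \<notin> X"
    have "?v \<in> cyc y"
      using z(1) stable_act[OF stable_cyc f] stable_subspace[OF stable_cyc]
      by (intro V.subspace_diff V.subspace_scale) auto
    then have "y \<in> cyc ?v" using cyc_eq v in_cyc by blast
    then obtain f' where f': "H.lf f'" "y = act f' ?v" by (auto simp: cyc_def)
    have "coef l ?v = 0" using g(2)[OF f] z(2) by (simp add: c.diff c.scale lact_coef[OF l f])
    then have "coef l y = 0"
      using lact_coef[OF l f'(1), of ?v] f'(2) linear_zeroD[OF H.lact_linear[OF f'(1)]] by simp
    with y0 show False by contradiction
  qed
  moreover have "z \<notin> X" using z(2) w(2) coef0 by blast
  ultimately show ?thesis using that z(1) cycY g(1) by blast
qed

end

section \<open>Weight spaces of a simple comodule algebra\<close>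

lemma (in pointed_hopf_algebra) dual_module_lact:
  "dual_module sH comult counit antipode B sH lact"
  by (intro dual_module.intro dual_module_axioms.intro)
     (rule pointed_hopf_algebra_axioms, rule vH, erule lact_linear, rule lact_fun_add, rule lact_fun_scale, rule lact_counit, erule (1) lact_lact)

locale simple_comodule_algebra =
  P: pointed_hopf_algebra sH comult counit antipode B +
  comodule_algebra sH comult counit antipode sA coact
  for sH :: "'k::field \<Rightarrow> 'h::ring_1 \<Rightarrow> 'h"
    and comult :: "'h \<Rightarrow> ('h \<times> 'h \<Rightarrow>\<^sub>0 'k)"
    and counit :: "'h \<Rightarrow> 'k"
    and antipode :: "'h \<Rightarrow> 'h"
    and B :: "'h set"
    and sA :: "'k \<Rightarrow> 'a::ring_1 \<Rightarrow> 'a"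
    and coact :: "'a \<Rightarrow> ('h \<times> 'a \<Rightarrow>\<^sub>0 'k)" +
  assumes simple: "right_H_simple sH sA coact"
    and coinv: "coinvariants sH sA coact = range (\<lambda>c. sA c 1)"
begin

lemma vA: "vector_space sA"
  by unfold_locales

lemma kA: "k_algebra sA"
  by unfold_locales

lemma coact_linear: "tensor_linear sA sH sA coact"
  and coact_mult: "tensor_eq sH sA (coact (a * b)) (tensor_mult (coact a) (coact b))"
  and coact_one: "tensor_eq sH sA (coact 1) (pure (1, 1))"
  using coact_algebra_map unfolding tensor_algebra_map_def by auto

definition cact :: "('h \<Rightarrow> 'k) \<Rightarrow> 'a \<Rightarrow> 'a" where "cact f a = contract sA f (coact a)"

lemma cact_linear: "P.lf f \<Longrightarrow> Vector_Spaces.linear sA sA (cact f)"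
  unfolding cact_def[abs_def] by (rule contract_tensor_linear[OF vA P.vH vA _ coact_linear])

sublocale C: dual_module sH comult counit antipode B sA cact
proof (intro dual_module.intro dual_module_axioms.intro)
  show "pointed_hopf_algebra sH comult counit antipode B" "vector_space sA" by unfold_locales
  show "Vector_Spaces.linear sA sA (cact f)" if "P.lf f" for f
    using that by (rule cact_linear)
  show "cact (\<lambda>h. f h + f' h) v = cact f v + cact f' v" for f f' v
    by (simp add: cact_def contract_fun_add[OF vA])
  show "cact (\<lambda>h. c * f h) v = sA c (cact f v)" for f c v
    by (simp add: cact_def contract_fun_scale[OF vA])
  show "cact counit v = v" for v
    using coact_counit by (simp add: cact_def contract_def)
  show "cact f (cact f' v) = cact (P.conv f' f) v" if "P.lf f" "P.lf f'" for f f' v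
    using that unfolding cact_def by (rule P.contract_contract[OF vA coact_linear _ _ coact_coassoc])
qed

lemma cact_mult:
  "P.lf f \<Longrightarrow> cact f (a * b) = free_lift sA (\<lambda>(x, b'). cact (\<lambda>h. f (h * x)) a * b') (coact b)"
  unfolding cact_def by (rule contract_mult[OF P.vH kA _ coact_mult])

text \<open>The elements with coaction \<open>g \<otimes> a\<close>, again tested by
  contractions.\<close>

definition weight_space :: "'h \<Rightarrow> 'a set"
  where "weight_space g = {a. \<forall>f. P.lf f \<longrightarrow> cact f a = sA (f g) a}"

lemma WtD: "a \<in> weight_space g \<Longrightarrow> P.lf f \<Longrightarrow> cact f a = sA (f g) a"
  by (simp add: weight_space_def)

lemma linear_mult_leftA: "Vector_Spaces.linear sA sA (\<lambda>b. a * b)"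
  by (rule linearI[OF vA vA]) (simp_all add: distrib_left A.scale_mult_right)

lemma cact_weight_space_mult:
  assumes a: "a \<in> weight_space g" and f: "P.lf f"
  shows "cact f (a * b) = a * cact (\<lambda>h. f (g * h)) b"
proof -
  have "cact f (a * b) = free_lift sA (\<lambda>z. a * (case z of (y, b') \<Rightarrow> sA (f (g * y)) b')) (coact b)"
    unfolding cact_mult[OF f]
    by (rule free_lift_cong)
       (auto simp: WtD[OF a P.lf_mult_right[OF f]] A.scale_mult_left A.scale_mult_right)
  then show ?thesis
    unfolding linear_free_lift[OF linear_mult_leftA, symmetric] cact_def contract_def .
qed

lemma weight_space_mult: "a \<in> weight_space g \<Longrightarrow> b \<in> weight_space h \<Longrightarrow> a * b \<in> weight_space (g * h)"
  unfolding weight_space_def[of "g * h"]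
  by (simp add: cact_weight_space_mult WtD P.lf_mult_left A.scale_mult_right)

text \<open>Since \<open>g\<close> is invertible, translation by \<open>g\<close> permutes the
  functionals.\<close>

lemma lf_shift:
  assumes "P.grouplike g" "P.lf f"
  obtains f' where "P.lf f'" "f = (\<lambda>h. f' (g * h))"
proof
  show "P.lf (\<lambda>h. f (antipode g * h))" by (rule P.lf_mult_left[OF assms(2)])
  show "f = (\<lambda>h. f (antipode g * (g * h)))"
    by (simp add: mult.assoc[symmetric] P.grouplike_antipode(1)[OF assms(1)])
qed

text \<open>Annihilators of vectors of weight \<open>g\<close> come with stability under the action
  twisted by \<open>g\<close>. The twist is removed by \<open>lf_shift\<close>, and expansion along
  \<open>B\<close> turns stability into the subcomodule condition.\<close>

lemma stable_right_ideal:
  assumes I: "right_ideal I" "A.subspace I" and g: "P.grouplike g"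
    and st: "\<And>f a. P.lf f \<Longrightarrow> a \<in> I \<Longrightarrow> cact (\<lambda>h. f (g * h)) a \<in> I"
  shows "I = {0} \<or> I = UNIV"
proof -
  have st': "cact f a \<in> I" if f: "P.lf f" and a: "a \<in> I" for f a
  proof -
    obtain f' where f': "P.lf f'" "f = (\<lambda>h. f' (g * h))" by (rule lf_shift[OF g f])
    show ?thesis using st[OF f'(1) a] by (simp add: f'(2))
  qed
  have "coact a \<in> tensor_sub sH sA UNIV I" if a: "a \<in> I" for a
  proof -
    let ?p = "\<lambda>i. pure (i, cact (P.coord i) a) :: 'h \<times> 'a \<Rightarrow>\<^sub>0 'k"
    have "tensor_eq sH sA (coact a) (\<Sum>i\<in>B. ?p i)"
      using tensor_eq_expand[OF P.vH vA P.finite_Basis P.independent_Basis P.span_Basis, of "coact a"]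
      by (simp add: cact_def P.coord_def[abs_def])
    moreover have "Poly_Mapping.keys (\<Sum>i\<in>B. ?p i) \<subseteq> UNIV \<times> I"
    proof -
      have "Poly_Mapping.keys (\<Sum>i\<in>B. ?p i) \<subseteq> (\<Union>i\<in>B. Poly_Mapping.keys (?p i))" by (rule keys_sum)
      also have "\<dots> \<subseteq> UNIV \<times> I" using st'[OF P.lf_coord a] by (auto simp: pure_def)
      finally show ?thesis .
    qed
    ultimately show ?thesis unfolding tensor_sub_def by (intro CollectI exI[of _ "\<Sum>i\<in>B. ?p i"] conjI)
  qed
  then have "subcomodule sH sA coact I" using I(2) by (simp add: subcomodule_def)
  then show ?thesis using simple I(1) by (simp add: right_H_simple_def)
qed

text \<open>The annihilator of \<open>a\<close> and the ideal \<open>a A\<close> are right ideals,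
  stable for the twists by \<open>g\<close> and by \<open>1\<close> respectively; right simplicity
  makes left multiplication by \<open>a\<close> bijective.\<close>

lemma weight_space_unit:
  assumes g: "P.grouplike g" and a: "a \<in> weight_space g" "a \<noteq> 0"
  obtains b where "a * b = 1" "b * a = 1" "b \<in> weight_space (antipode g)"
proof -
  interpret l: Vector_Spaces.linear sA sA "\<lambda>b. a * b" by (rule linear_mult_leftA)
  let ?K = "{b. a * b = 0}"
  have "?K = {0} \<or> ?K = UNIV"
  proof (rule stable_right_ideal[OF _ _ g])
    show "right_ideal ?K" by (simp add: right_ideal_def right_diff_distrib mult.assoc[symmetric])
    show "A.subspace ?K" by (rule l.subspace_kernel)
    fix f b assume f: "P.lf f" and "b \<in> ?K"
    then show "cact (\<lambda>h. f (g * h)) b \<in> ?K"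
      using cact_weight_space_mult[OF a(1) f, of b] by (simp add: linear_zeroD[OF cact_linear[OF f]])
  qed
  moreover have "?K \<noteq> UNIV"
  proof
    assume "?K = UNIV"
    then have "1 \<in> ?K" by simp
    with a(2) show False by simp
  qed
  ultimately have inj: "b = b'" if "a * b = a * b'" for b b'
  proof -
    have "b - b' \<in> ?K" using that by (simp add: right_diff_distrib)
    with \<open>?K = {0} \<or> ?K = UNIV\<close> \<open>?K \<noteq> UNIV\<close> have "b - b' \<in> {0}" by simp
    then show ?thesis by simp
  qed
  let ?I = "range (\<lambda>b. a * b)"
  have "?I = {0} \<or> ?I = UNIV"
  proof (rule stable_right_ideal[OF _ _ P.grouplike_one])
    have "0 \<in> ?I" using rangeI[of "\<lambda>b. a * b" 0] by simp
    moreover have "x - y \<in> ?I" if "x \<in> ?I" "y \<in> ?I" for x y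
      using that by (auto simp: right_diff_distrib[symmetric])
    moreover have "x * y \<in> ?I" if "x \<in> ?I" for x y
      using that by (auto simp: mult.assoc)
    ultimately show "right_ideal ?I" unfolding right_ideal_def by blast
    show "A.subspace ?I" using l.subspace_image[OF A.subspace_UNIV] by simp
    fix f b assume f: "P.lf f" and "b \<in> ?I"
    then show "cact (\<lambda>h. f (1 * h)) b \<in> ?I" using cact_weight_space_mult[OF a(1) f] by auto
  qed
  moreover have "?I \<noteq> {0}" using rangeI[of "\<lambda>b. a * b" 1] a(2) by auto
  ultimately have "1 \<in> ?I" by blast
  then obtain b where ab: "a * b = 1" by (metis rangeE)
  have "a * (b * a) = a * 1" by (simp add: mult.assoc[symmetric] ab)
  then have ba: "b * a = 1" by (rule inj)
  \<comment> \<open>The weight of \<open>b\<close> is read off by letting functionals act on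
    \<open>a * b = 1\<close> and cancelling \<open>a\<close>.\<close>
  have "b \<in> weight_space (antipode g)"
    unfolding weight_space_def
  proof (intro CollectI allI impI)
    fix f assume f: "P.lf f"
    obtain f' where f': "P.lf f'" "f = (\<lambda>h. f' (g * h))" by (rule lf_shift[OF g f])
    have "cact f' 1 = sA (f' 1) 1"
      using contract_cong[OF P.vH vA f'(1) coact_one] by (simp add: cact_def contract_pure[OF vA])
    then have "a * cact f b = a * sA (f' 1) b"
      using cact_weight_space_mult[OF a(1) f'(1), of b] by (simp add: ab f'(2) A.scale_mult_right)
    then have "cact f b = sA (f' 1) b" by (rule inj)
    moreover have "f' 1 = f (antipode g)" by (simp add: f'(2) P.grouplike_antipode(2)[OF g])
    ultimately show "cact f b = sA (f (antipode g)) b" by simp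
  qed
  with ab ba that show ?thesis by blast
qed

text \<open>Weight \<open>1\<close> means coinvariant; this is the point where triviality of the
  coinvariants enters.\<close>

lemma weight_space_one:
  assumes "a \<in> weight_space 1" obtains c where "a = sA c 1"
proof -
  have "tensor_eq sH sA (coact a) (pure (1, a))"
    by (rule P.tensor_eqI[OF vA]) (use assms in \<open>simp add: WtD cact_def[symmetric] contract_pure[OF vA]\<close>)
  then have "a \<in> coinvariants sH sA coact" by (simp add: coinvariants_def)
  then show ?thesis using coinv that by auto
qed

lemma one_weight_space: "1 \<in> weight_space 1"
  unfolding weight_space_def
  using contract_cong[OF P.vH vA _ coact_one] by (simp add: cact_def contract_pure[OF vA])

text \<open>Dividing \<open>b\<close> by the unit \<open>a\<close> leaves a vector of weight
  \<open>1\<close>, hence a scalar.\<close>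

lemma weight_space_unique:
  assumes g: "P.grouplike g" and a: "a \<in> weight_space g" "a \<noteq> 0" and b: "b \<in> weight_space g"
  obtains c where "b = sA c a"
proof -
  obtain a' where a': "a * a' = 1" "a' * a = 1" "a' \<in> weight_space (antipode g)" by (rule weight_space_unit[OF g a])
  have "a' * b \<in> weight_space 1"
    using weight_space_mult[OF a'(3) b] by (simp add: P.grouplike_antipode(1)[OF g])
  then obtain c where "a' * b = sA c 1" by (rule weight_space_one)
  then have "a * (a' * b) = sA c a" by (simp add: A.scale_mult_right)
  then have "b = sA c a" by (simp add: mult.assoc[symmetric] a'(1))
  then show ?thesis by (rule that)
qed

section \<open>The group of weights and the comodule embedding of A into H\<close>

definition weights :: "'h set" where "weights = {g. P.grouplike g \<and> (\<exists>a\<in>weight_space g. a \<noteq> 0)}"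

definition wvec :: "'h \<Rightarrow> 'a" where "wvec g = (SOME a. a \<in> weight_space g \<and> a \<noteq> 0)"

lemma weights_grouplike: "g \<in> weights \<Longrightarrow> P.grouplike g"
  by (simp add: weights_def)

lemma wvec: "g \<in> weights \<Longrightarrow> wvec g \<in> weight_space g" "g \<in> weights \<Longrightarrow> wvec g \<noteq> 0"
  using someI_ex[of "\<lambda>a. a \<in> weight_space g \<and> a \<noteq> 0"] by (auto simp: weights_def wvec_def)

lemma weights_one: "1 \<in> weights"
  unfolding weights_def using P.grouplike_one one_weight_space one_neq_zero by blast

lemma weights_mult: "g \<in> weights \<Longrightarrow> h \<in> weights \<Longrightarrow> g * h \<in> weights"
proof -
  assume gh: "g \<in> weights" "h \<in> weights"
  obtain b where b: "wvec g * b = 1" "b * wvec g = 1"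
    by (rule weight_space_unit[OF weights_grouplike[OF gh(1)] wvec[OF gh(1)]])
  have "wvec g * wvec h \<noteq> 0"
  proof
    assume "wvec g * wvec h = 0"
    then have "b * (wvec g * wvec h) = 0" by simp
    then show False using wvec(2)[OF gh(2)] by (simp add: mult.assoc[symmetric] b(2))
  qed
  then show ?thesis
    unfolding weights_def using weight_space_mult[OF wvec(1)[OF gh(1)] wvec(1)[OF gh(2)]] P.grouplike_mult weights_grouplike gh by blast
qed

lemma weights_antipode: "g \<in> weights \<Longrightarrow> antipode g \<in> weights"
proof -
  assume g: "g \<in> weights"
  obtain b where b: "wvec g * b = 1" "b * wvec g = 1" "b \<in> weight_space (antipode g)"
    by (rule weight_space_unit[OF weights_grouplike[OF g] wvec[OF g]])
  then have "b \<noteq> 0" by auto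
  then show ?thesis
    unfolding weights_def using b(3) P.grouplike_antipode(3)[OF weights_grouplike[OF g]] by blast
qed

lemma ex_wfun: "\<exists>m. Vector_Spaces.linear sA (*) m \<and> (\<forall>g\<in>weights. m (wvec g) = 1)"
proof -
  have weight: "C.weight_mod {0} g (wvec g)" if "g \<in> weights" for g
    unfolding C.weight_mod_def using WtD[OF wvec(1)[OF that]] by simp
  have nz: "wvec g \<notin> {0}" if "g \<in> weights" for g using wvec(2)[OF that] by simp
  show ?thesis
    using C.ex_weight_functional[where c = "\<lambda>_. 1", OF C.stable_zero nz weight] by blast
qed

definition wfun :: "'a \<Rightarrow> 'k"
  where "wfun = (SOME m. Vector_Spaces.linear sA (*) m \<and> (\<forall>g\<in>weights. m (wvec g) = 1))"

lemma wfun: "Vector_Spaces.linear sA (*) wfun" "g \<in> weights \<Longrightarrow> wfun (wvec g) = 1"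
  using someI_ex[OF ex_wfun] by (auto simp: wfun_def)

text \<open>A nonzero kernel would be stable and contain a weight vector, which is a multiple of
  some \<open>wvec g\<close>; but \<open>wfun\<close> does not vanish there. The embedding bounds
  the dimension of \<open>A\<close>.\<close>

lemma inj_coef_wfun: "inj (C.coef wfun)"
proof -
  interpret c: Vector_Spaces.linear sA sH "C.coef wfun" by (rule C.coef_linear[OF wfun(1)])
  let ?K = "{a. C.coef wfun a = 0}"
  have K: "C.stable ?K"
  proof (rule C.stableI)
    show "A.subspace ?K" by (rule c.subspace_kernel)
    fix f a assume f: "P.lf f" and "a \<in> ?K"
    then show "cact f a \<in> ?K"
      using C.lact_coef[OF wfun(1) f, of a] by (simp add: linear_zeroD[OF P.lact_linear[OF f]])
  qed
  have "?K = {0}"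
  proof (rule ccontr)
    assume "?K \<noteq> {0}"
    then have "{0} \<subset> ?K" using A.subspace_0[OF C.stable_subspace[OF K]] by blast
    then obtain v g where v: "v \<in> ?K" "v \<notin> {0}" "P.grouplike g" "C.weight_mod {0} g v"
      by (rule C.ex_weight_vector[OF C.stable_zero K])
    then have "v \<in> weight_space g" "v \<noteq> 0" by (auto simp: C.weight_mod_def weight_space_def)
    with v(3) have g: "g \<in> weights" by (auto simp: weights_def)
    obtain c where c: "v = sA c (wvec g)" by (rule weight_space_unique[OF v(3) wvec[OF g] \<open>v \<in> weight_space g\<close>])
    have "wfun v = 0" using C.counit_coef[OF wfun(1), of v] v(1) by (simp add: linear_zeroD[OF P.lf_counit])
    then have "c = 0" by (simp add: c linear_scaleD[OF wfun(1)] wfun(2)[OF g])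
    with c \<open>v \<noteq> 0\<close> show False by simp
  qed
  then show ?thesis unfolding c.inj_iff_eq_0 by blast
qed

lemma finite_dim_A: "\<exists>BA. finite_dimensional_vector_space sA BA"
proof -
  interpret c: Vector_Spaces.linear sA sH "C.coef wfun" by (rule C.coef_linear[OF wfun(1)])
  obtain BA where BA: "A.independent BA" "A.span BA = UNIV"
    using A.maximal_independent_subset[of UNIV] by (auto simp: top_unique)
  have "P.independent (C.coef wfun ` BA)"
    by (rule c.independent_inj_image[OF BA(1) inj_coef_wfun])
  then have "finite (C.coef wfun ` BA)" by (rule P.finiteI_independent)
  then have "finite BA" by (rule finite_imageD[OF _ inj_on_subset[OF inj_coef_wfun subset_UNIV]])
  with BA have "finite_dimensional_vector_space sA BA"
    by (intro finite_dimensional_vector_space.intro finite_dimensional_vector_space_axioms.intro vA)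
  then show ?thesis by blast
qed

section \<open>The cofree Hopf module\<close>

text \<open>\<open>Hom(A, H)\<close> is \<open>H \<otimes> A\<^sup>*\<close>, the Hopf module cofreely generated by the dual of \<open>A\<close>.\<close>

definition hom_space :: "('a \<Rightarrow> 'h) set" where "hom_space = {T. Vector_Spaces.linear sA sH T}"

text \<open>Scalars and action are defined for all functions, because the type contains them; the
  linear maps are then the stable subspace \<open>hom_space\<close>.\<close>

definition hom_scale :: "'k \<Rightarrow> ('a \<Rightarrow> 'h) \<Rightarrow> 'a \<Rightarrow> 'h" where "hom_scale c T = (\<lambda>b. sH c (T b))"

definition hom_act :: "('h \<Rightarrow> 'k) \<Rightarrow> ('a \<Rightarrow> 'h) \<Rightarrow> 'a \<Rightarrow> 'h" where "hom_act f T = (\<lambda>b. P.lact f (T b))"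

text \<open>In Sweedler notation \<open>(T a)(b) = T(a_0 b) a_{-1}\<close>. On
  \<open>h \<otimes> p\<close> with \<open>p\<close> in the dual of \<open>A\<close> this is the
  diagonal action \<open>h a_{-1} \<otimes> p a_0\<close>, where
  \<open>(p a)(b) = p(a b)\<close>.\<close>

definition hom_mult :: "('a \<Rightarrow> 'h) \<Rightarrow> 'a \<Rightarrow> 'a \<Rightarrow> 'h"
  where "hom_mult T a = (\<lambda>b. free_lift sH (\<lambda>(x, a'). T (a' * b) * x) (coact a))"

lemma vM: "vector_space hom_scale"
  by unfold_locales
     (simp_all add: hom_scale_def fun_eq_iff P.scale_right_distrib P.scale_left_distrib)

sublocale M: dual_module sH comult counit antipode B hom_scale hom_act
proof (intro dual_module.intro dual_module_axioms.intro)
  show "pointed_hopf_algebra sH comult counit antipode B" by unfold_locales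
  show "vector_space hom_scale" by (rule vM)
  show "Vector_Spaces.linear hom_scale hom_scale (hom_act f)" if "P.lf f" for f
    by (rule linearI[OF vM vM])
       (simp_all add: hom_act_def hom_scale_def fun_eq_iff linear_addD[OF P.lact_linear[OF that]]
         linear_scaleD[OF P.lact_linear[OF that]])
  show "hom_act (\<lambda>h. f h + f' h) v = hom_act f v + hom_act f' v" for f f' v
    by (simp add: hom_act_def fun_eq_iff P.lact_fun_add)
  show "hom_act (\<lambda>h. c * f h) v = hom_scale c (hom_act f v)" for f c v
    by (simp add: hom_act_def hom_scale_def fun_eq_iff P.lact_fun_scale)
  show "hom_act counit v = v" for v
    by (simp add: hom_act_def P.lact_counit)
  show "hom_act f (hom_act f' v) = hom_act (P.conv f' f) v" if "P.lf f" "P.lf f'" for f f' v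
    using that by (simp add: hom_act_def P.lact_lact)
qed

lemma hom_space_linear: "T \<in> hom_space \<Longrightarrow> Vector_Spaces.linear sA sH T"
  by (simp add: hom_space_def)

lemma subspace_hom_space: "M.V.subspace hom_space"
  by (rule M.V.subspaceI)
     (auto simp: hom_space_def hom_scale_def vA P.vH Vector_Spaces.linear_iff P.scale_right_distrib add_ac mult.commute)

lemma stable_hom_space: "M.stable hom_space"
proof (rule M.stableI[OF subspace_hom_space])
  fix f T assume "P.lf f" "T \<in> hom_space"
  then show "hom_act f T \<in> hom_space"
    unfolding hom_space_def hom_act_def using linear_compD[OF _ P.lact_linear] by auto
qed

lemma linear_coact_tensor:
  assumes "T \<in> hom_space"
  shows "Vector_Spaces.linear sH sH (\<lambda>x. case (x, a') of (x, a') \<Rightarrow> T (a' * b) * x)"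
    and "Vector_Spaces.linear sA sH (\<lambda>a'. case (x, a') of (x, a') \<Rightarrow> T (a' * b) * x)"
proof -
  note T = hom_space_linear[OF assms]
  show "Vector_Spaces.linear sH sH (\<lambda>x. case (x, a') of (x, a') \<Rightarrow> T (a' * b) * x)"
    by (rule linearI[OF P.vH P.vH]) (simp_all add: distrib_left P.scale_mult_right)
  show "Vector_Spaces.linear sA sH (\<lambda>a'. case (x, a') of (x, a') \<Rightarrow> T (a' * b) * x)"
    by (rule linearI[OF vA P.vH])
       (simp_all add: distrib_right A.scale_mult_left P.scale_mult_left linear_addD[OF T] linear_scaleD[OF T])
qed

lemma hom_mult_cong:
  assumes "T \<in> hom_space" "tensor_eq sH sA (coact a) q"
  shows "hom_mult T a b = free_lift sH (\<lambda>(x, a'). T (a' * b) * x) q"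
  unfolding hom_mult_def
  by (rule free_lift_tensor_cong[OF P.vH vA P.vH linear_coact_tensor[OF assms(1)] assms(2)])

lemma hom_mult_in:
  assumes "T \<in> hom_space" shows "hom_mult T a \<in> hom_space"
proof -
  note T = hom_space_linear[OF assms]
  have "hom_mult T a (x + y) = hom_mult T a x + hom_mult T a y" for x y
    unfolding hom_mult_def free_lift_fun_add[OF P.vH, symmetric]
    by (simp add: case_prod_unfold distrib_left distrib_right linear_addD[OF T])
  moreover have "hom_mult T a (sA c x) = sH c (hom_mult T a x)" for c x
    unfolding hom_mult_def free_lift_fun_scale[OF P.vH, symmetric]
    by (simp add: case_prod_unfold A.scale_mult_right P.scale_mult_left linear_scaleD[OF T])
  ultimately show ?thesis unfolding hom_space_def by (auto intro: linearI[OF vA P.vH])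
qed

lemma hom_mult_linear_right:
  assumes "T \<in> hom_space" shows "Vector_Spaces.linear sA hom_scale (hom_mult T)"
proof (rule linearI[OF vA vM]; rule ext)
  fix a a' b c
  have l: "Vector_Spaces.linear free_scale sH (free_lift sH f)" for f :: "'h \<times> 'a \<Rightarrow> 'h"
    by (rule vector_space.free_lift_linear[OF P.vH])
  have "tensor_eq sH sA (coact (a + a')) (coact a + coact a')" "tensor_eq sH sA (coact (sA c a)) (free_scale c (coact a))"
    using coact_linear by (auto simp: tensor_linear_def)
  note t = hom_mult_cong[OF assms this(1)] hom_mult_cong[OF assms this(2)]
  show "hom_mult T (a + a') b = (hom_mult T a + hom_mult T a') b" "hom_mult T (sA c a) b = hom_scale c (hom_mult T a) b"
    unfolding t linear_addD[OF l] linear_scaleD[OF l] by (simp_all add: hom_mult_def hom_scale_def)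
qed

lemma hom_mult_linear_left: "Vector_Spaces.linear hom_scale hom_scale (\<lambda>T. hom_mult T a)"
proof (rule linearI[OF vM vM]; rule ext)
  fix T T' c b
  show "hom_mult (T + T') a b = (hom_mult T a + hom_mult T' a) b"
    by (simp add: hom_mult_def free_lift_fun_add[OF P.vH, symmetric] case_prod_unfold distrib_right)
  show "hom_mult (hom_scale c T) a b = hom_scale c (hom_mult T a) b"
    by (simp add: hom_mult_def hom_scale_def free_lift_fun_scale[OF P.vH, symmetric] case_prod_unfold P.scale_mult_left)
qed

lemma hom_mult_weight_space:
  assumes "T \<in> hom_space" "a \<in> weight_space y" shows "hom_mult T a = (\<lambda>b. T (a * b) * y)"
proof -
  have "tensor_eq sH sA (coact a) (pure (y, a))"
    by (rule P.tensor_eqI[OF vA]) (use assms(2) in \<open>simp add: WtD cact_def[symmetric] contract_pure[OF vA]\<close>)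
  then show ?thesis
    using hom_mult_cong[OF assms(1)] by (simp add: fun_eq_iff vector_space.free_lift_pure[OF P.vH])
qed

lemma hom_mult_one: "T \<in> hom_space \<Longrightarrow> hom_mult T 1 = T"
  using hom_mult_weight_space[OF _ one_weight_space] by simp

lemma hom_mult_hom_mult:
  assumes T: "T \<in> hom_space"
  shows "hom_mult (hom_mult T a) a' = hom_mult T (a * a')"
proof
  fix b
  have "hom_mult T (a * a') b = free_lift sH (\<lambda>(x, d). T (d * b) * x) (tensor_mult (coact a) (coact a'))"
    by (rule hom_mult_cong[OF T coact_mult])
  also have "\<dots> = free_lift sH (\<lambda>(v, w). free_lift sH (\<lambda>(v', w'). T (w * w' * b) * (v * v')) (coact a')) (coact a)"
    unfolding tensor_mult_def free_lift_bind[OF P.vH]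
    by (simp add: case_prod_unfold free_lift_bind[OF P.vH] vector_space.free_lift_pure[OF P.vH])
  also have "\<dots> = free_lift sH (\<lambda>(v', w'). free_lift sH (\<lambda>(v, w). T (w * w' * b) * (v * v')) (coact a)) (coact a')"
    unfolding free_lift_def case_prod_unfold P.scale_sum_right
    by (subst sum.swap) (simp add: mult.commute)
  also have "\<dots> = hom_mult (hom_mult T a) a' b"
    unfolding hom_mult_def free_lift_def case_prod_unfold sum_distrib_right
    by (simp add: P.scale_mult_left mult.assoc)
  finally show "hom_mult (hom_mult T a) a' b = hom_mult T (a * a') b" ..
qed

text \<open>The Hopf module compatibility, contracted with \<open>f\<close>. Expanding
  \<open>T(a_0 b) a_{-1}\<close> splits the leg \<open>a_{-1}\<close>; coassociativity moves the
  splitting to \<open>a_0\<close>, where it forms \<open>hom_mult\<close> again.\<close>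

lemma hom_act_hom_mult:
  assumes T: "T \<in> hom_space" and f: "P.lf f"
  shows "hom_act f (hom_mult T a) = free_lift hom_scale (\<lambda>(x, a'). hom_mult (hom_act (\<lambda>h. f (h * x)) T) a') (coact a)"
proof
  fix b
  note Tl = hom_space_linear[OF T]
  let ?F = "\<lambda>y x' a'. P.lact (\<lambda>h. f (h * y)) (T (a' * b)) * x'"
  have ev: "Vector_Spaces.linear hom_scale sH (\<lambda>T. T b)"
    by (rule linearI[OF vM P.vH]) (simp_all add: hom_scale_def)
  have "hom_act f (hom_mult T a) b = free_lift sH (\<lambda>(x, a'). P.lact f (T (a' * b) * x)) (coact a)"
    unfolding hom_act_def hom_mult_def linear_free_lift[OF P.lact_linear[OF f]] by (simp add: case_prod_unfold)
  also have "\<dots> = free_lift sH (\<lambda>(x, a'). free_lift sH (\<lambda>(y, x'). ?F y x' a') (comult x)) (coact a)"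
    unfolding P.lact_mult[OF f] ..
  also have "\<dots> = free_lift sH (\<lambda>(x, a'). free_lift sH (\<lambda>(x', a''). ?F x x' a'') (coact a')) (coact a)"
  proof (rule coassoc_apply[OF P.vH vA P.vH _ _ _ coact_coassoc])
    fix y x' a'
    have eq: "(\<lambda>h. f (h * (y + z))) = (\<lambda>h. f (h * y) + f (h * z))" "(\<lambda>h. f (h * sH c y)) = (\<lambda>h. c * f (h * y))" for y z c
      by (simp_all add: distrib_left P.scale_mult_right linear_addD[OF f] linear_scaleD[OF f])
    show "Vector_Spaces.linear sH sH (\<lambda>y. ?F y x' a')"
      by (rule linearI[OF P.vH P.vH])
         (simp_all only: eq P.lact_fun_add P.lact_fun_scale distrib_right P.scale_mult_left)
    show "Vector_Spaces.linear sH sH (\<lambda>x'. ?F y x' a')"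
      by (rule P.linear_mult_left)
    note l = P.lact_linear[OF P.lf_mult_right[OF f, of y]]
    show "Vector_Spaces.linear sA sH (\<lambda>a'. ?F y x' a')"
      by (rule linearI[OF vA P.vH])
         (simp_all add: distrib_right A.scale_mult_left P.scale_mult_left linear_addD[OF Tl] linear_scaleD[OF Tl]
           linear_addD[OF l] linear_scaleD[OF l])
  qed
  also have "\<dots> = free_lift hom_scale (\<lambda>(x, a'). hom_mult (hom_act (\<lambda>h. f (h * x)) T) a') (coact a) b"
    unfolding linear_free_lift[OF ev] by (simp add: case_prod_unfold hom_mult_def hom_act_def)
  finally show "hom_act f (hom_mult T a) b = free_lift hom_scale (\<lambda>(x, a'). hom_mult (hom_act (\<lambda>h. f (h * x)) T) a') (coact a) b" .
qed

section \<open>Hopf submodules of Hom(A, H)\<close>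

definition hopf_sub :: "('a \<Rightarrow> 'h) set \<Rightarrow> bool"
  where "hopf_sub X \<longleftrightarrow> X \<subseteq> hom_space \<and> M.stable X \<and> (\<forall>T\<in>X. \<forall>a. hom_mult T a \<in> X)"

lemma hopf_subD:
  assumes "hopf_sub X"
  shows "X \<subseteq> hom_space" "M.stable X" "M.V.subspace X" "T \<in> X \<Longrightarrow> hom_mult T a \<in> X"
  using assms M.stable_subspace by (auto simp: hopf_sub_def)

text \<open>Modulo \<open>X\<close>, the map \<open>hom_mult T\<close> intertwines the action on
  \<open>A\<close> twisted by \<open>g\<close> with \<open>hom_act\<close>: the deviations of
  \<open>T\<close> from weight \<open>g\<close> lie in \<open>X\<close>, which absorbs
  multiplication by \<open>A\<close>.\<close>

lemma hom_act_hom_mult_weight: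
  assumes X: "hopf_sub X" and T: "T \<in> hom_space" and w: "M.weight_mod X g T" and f: "P.lf f"
  shows "hom_act f (hom_mult T a) - hom_mult T (cact (\<lambda>h. f (g * h)) a) \<in> X"
proof -
  have "hom_mult T (cact (\<lambda>h. f (g * h)) a) = free_lift hom_scale (\<lambda>(x, a'). hom_scale (f (g * x)) (hom_mult T a')) (coact a)"
    unfolding cact_def contract_def linear_free_lift[OF hom_mult_linear_right[OF T]]
    by (simp add: case_prod_unfold linear_scaleD[OF hom_mult_linear_right[OF T]])
  then have "hom_act f (hom_mult T a) - hom_mult T (cact (\<lambda>h. f (g * h)) a)
    = free_lift hom_scale (\<lambda>z. (case z of (x, a') \<Rightarrow> hom_mult (hom_act (\<lambda>h. f (h * x)) T) a')
        - (case z of (x, a') \<Rightarrow> hom_scale (f (g * x)) (hom_mult T a'))) (coact a)"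
    by (simp only: hom_act_hom_mult[OF T f] free_lift_fun_diff[OF vM])
  also have "\<dots> = free_lift hom_scale (\<lambda>(x, a'). hom_mult (hom_act (\<lambda>h. f (h * x)) T - hom_scale (f (g * x)) T) a') (coact a)"
    by (rule free_lift_cong)
       (auto simp: linear_diffD[OF hom_mult_linear_left] linear_scaleD[OF hom_mult_linear_left])
  also have "\<dots> \<in> X"
    by (rule free_lift_in_subspace[OF vM hopf_subD(3)[OF X]])
       (use w P.lf_mult_right[OF f] hopf_subD(4)[OF X] in \<open>auto simp: M.weight_mod_def\<close>)
  finally show ?thesis .
qed

text \<open>The annihilator of \<open>T\<close> in the quotient by \<open>X\<close> is a right ideal stable under the coaction of
  \<open>A\<close> twisted by \<open>g\<close>.\<close>

lemma hom_mult_mem_imp_zero: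
  assumes X: "hopf_sub X" and T: "T \<in> hom_space" "T \<notin> X" and g: "P.grouplike g" and w: "M.weight_mod X g T"
    and a: "hom_mult T a \<in> X"
  shows "a = 0"
proof -
  interpret l: Vector_Spaces.linear sA hom_scale "hom_mult T" by (rule hom_mult_linear_right[OF T(1)])
  note Xs = hopf_subD(3)[OF X]
  let ?I = "{a. hom_mult T a \<in> X}"
  have "?I = {0} \<or> ?I = UNIV"
  proof (rule stable_right_ideal[OF _ _ g])
    show "A.subspace ?I" by (rule l.subspace_linear_preimage[OF Xs])
    show "right_ideal ?I"
      unfolding right_ideal_def
      using M.V.subspace_0[OF Xs] M.V.subspace_diff[OF Xs] hopf_subD(4)[OF X]
      by (auto simp: l.zero l.diff hom_mult_hom_mult[OF T(1), symmetric])
    fix f b assume f: "P.lf f" and b: "b \<in> ?I"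
    then have "hom_act f (hom_mult T b) \<in> X" using M.stable_act[OF hopf_subD(2)[OF X] f] by simp
    from M.V.subspace_diff[OF Xs this hom_act_hom_mult_weight[OF X T(1) w f, of b]]
    show "cact (\<lambda>h. f (g * h)) b \<in> ?I" by simp
  qed
  moreover have "1 \<notin> ?I" using T hom_mult_one by simp
  ultimately have "?I = {0}" by auto
  with a show ?thesis by blast
qed

text \<open>The twisted copy of \<open>A\<close> generated by \<open>T\<close> is stable modulo
  \<open>X\<close>; adding \<open>X\<close> makes it a Hopf submodule.\<close>

lemma hopf_sub_extend:
  assumes X: "hopf_sub X" and T: "T \<in> hom_space" and w: "M.weight_mod X g T"
  shows "hopf_sub {x + y | x y. x \<in> X \<and> y \<in> range (hom_mult T)}" (is "hopf_sub ?Y")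
proof -
  interpret l: Vector_Spaces.linear sA hom_scale "hom_mult T" by (rule hom_mult_linear_right[OF T])
  note Xs = hopf_subD(3)[OF X]
  have Ys: "M.V.subspace ?Y"
    by (rule M.V.subspace_sums[OF Xs]) (use l.subspace_image[OF A.subspace_UNIV] in simp)
  have "?Y \<subseteq> hom_space"
    using hopf_subD(1)[OF X] hom_mult_in[OF T] M.V.subspace_add[OF subspace_hom_space] by blast
  moreover have "M.stable ?Y"
  proof (rule M.stableI[OF Ys])
    fix f S assume f: "P.lf f" and "S \<in> ?Y"
    then obtain x a where x: "x \<in> X" "S = x + hom_mult T a" by blast
    let ?a = "cact (\<lambda>h. f (g * h)) a"
    have "hom_act f S = (hom_act f x + (hom_act f (hom_mult T a) - hom_mult T ?a)) + hom_mult T ?a"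
      by (simp add: x(2) M.act_add[OF f])
    moreover have "hom_act f x + (hom_act f (hom_mult T a) - hom_mult T ?a) \<in> X"
      by (rule M.V.subspace_add[OF Xs M.stable_act[OF hopf_subD(2)[OF X] f x(1)] hom_act_hom_mult_weight[OF X T w f]])
    ultimately show "hom_act f S \<in> ?Y" by blast
  qed
  moreover have "hom_mult S a \<in> ?Y" if "S \<in> ?Y" for S a
  proof -
    from that obtain x b where x: "x \<in> X" "S = x + hom_mult T b" by blast
    then have "hom_mult S a = hom_mult x a + hom_mult T (b * a)"
      by (simp add: linear_addD[OF hom_mult_linear_left] hom_mult_hom_mult[OF T])
    with hopf_subD(4)[OF X x(1)] show ?thesis by blast
  qed
  ultimately show ?thesis unfolding hopf_sub_def by blast
qed

lemma subset_extend:
  assumes "hopf_sub X" "T \<in> hom_space"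
  shows "X \<subseteq> {x + y | x y. x \<in> X \<and> y \<in> range (hom_mult T)}" "T \<in> {x + y | x y. x \<in> X \<and> y \<in> range (hom_mult T)}"
proof -
  have "x = x + hom_mult T 0" for x
    using linear_zeroD[OF hom_mult_linear_right[OF assms(2)]] by simp
  then show "X \<subseteq> {x + y | x y. x \<in> X \<and> y \<in> range (hom_mult T)}" by blast
  have "T = 0 + hom_mult T 1" using hom_mult_one[OF assms(2)] by simp
  then show "T \<in> {x + y | x y. x \<in> X \<and> y \<in> range (hom_mult T)}"
    using M.V.subspace_0[OF hopf_subD(3)[OF assms(1)]] by blast
qed

section \<open>The maximal Hopf submodule avoiding all weights\<close>

sublocale D: dual_module sH comult counit antipode B sH P.lact
  by (rule P.dual_module_lact)

text \<open>The value depends only on the coset of \<open>g\<close>, since the choice is made from that set.\<close>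

definition coset_rep :: "'h \<Rightarrow> 'h" where "coset_rep g = (SOME t. t \<in> (\<lambda>x. g * x) ` weights)"

text \<open>The factor from \<open>weights\<close> in
  \<open>g = coset_rep g * coset_part g\<close>.\<close>

definition coset_part :: "'h \<Rightarrow> 'h" where "coset_part g = antipode (coset_rep g) * g"

lemma grouplike_solve: "P.grouplike g \<Longrightarrow> antipode g * (g * x) = x" "P.grouplike g \<Longrightarrow> g * (antipode g * x) = x"
  by (simp_all add: mult.assoc[symmetric] P.grouplike_antipode)

lemma coset_rep_in: "coset_rep g \<in> (\<lambda>x. g * x) ` weights"
  unfolding coset_rep_def by (rule someI_ex) (use weights_one in blast)

lemma antipode_mult:
  assumes "P.grouplike g" "P.grouplike h"
  shows "antipode (g * h) = antipode h * antipode g"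
proof -
  have gh: "P.grouplike (g * h)" by (rule P.grouplike_mult[OF assms])
  have "(g * h) * (antipode h * antipode g) = 1"
    by (simp add: mult.assoc grouplike_solve assms P.grouplike_antipode(2))
  then have "antipode (g * h) * ((g * h) * (antipode h * antipode g)) = antipode (g * h)" by simp
  then show ?thesis by (simp only: grouplike_solve(1)[OF gh])
qed

lemma coset_part_weights: assumes "P.grouplike g" shows "coset_part g \<in> weights"
proof -
  obtain x where x: "x \<in> weights" "coset_rep g = g * x" using coset_rep_in by blast
  have "coset_part g = antipode x"
    using x(2) by (simp add: coset_part_def antipode_mult assms weights_grouplike[OF x(1)] mult.assoc P.grouplike_antipode(1))
  then show ?thesis using weights_antipode[OF x(1)] by simp
qed

text \<open>Translation by \<open>x\<close> permutes the group \<open>weights\<close>, so both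
  choices are made from the same set.\<close>

lemma coset_rep_mult:
  assumes "P.grouplike g" "x \<in> weights" shows "coset_rep (g * x) = coset_rep g"
proof -
  have "(\<lambda>y. g * x * y) ` weights = (\<lambda>y. g * y) ` weights"
  proof (intro equalityI subsetI)
    fix z assume "z \<in> (\<lambda>y. g * x * y) ` weights"
    then show "z \<in> (\<lambda>y. g * y) ` weights" using weights_mult[OF assms(2)] by (auto simp: mult.assoc)
  next
    fix z assume "z \<in> (\<lambda>y. g * y) ` weights"
    then obtain y where y: "y \<in> weights" "z = g * y" by blast
    then have "z = g * x * (antipode x * y)"
      by (simp add: mult.assoc grouplike_solve(2)[OF weights_grouplike[OF assms(2)]])
    then show "z \<in> (\<lambda>y. g * x * y) ` weights" using weights_mult[OF weights_antipode[OF assms(2)] y(1)] by blast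
  qed
  then show ?thesis by (simp add: coset_rep_def)
qed

lemma coset_part_mult: "P.grouplike g \<Longrightarrow> x \<in> weights \<Longrightarrow> coset_part (g * x) = coset_part g * x"
  by (simp add: coset_part_def coset_rep_mult mult.assoc)

text \<open>One vector of each grouplike weight in \<open>Hom(A, H)\<close>, compatible up to scalars with the
  action of the weight vectors of \<open>A\<close>.\<close>

definition soc_fun :: "'h \<Rightarrow> 'a \<Rightarrow> 'k" where "soc_fun g b = wfun (wvec (coset_part g) * b)"

text \<open>With \<open>r = coset_rep g\<close> and \<open>x = coset_part g\<close>, this is the
  product of \<open>r \<otimes> wfun\<close> with \<open>wvec x\<close>, since
  \<open>r * x = g\<close>. A single vector per coset thus determines the family.\<close>

definition soc_gen :: "'h \<Rightarrow> 'a \<Rightarrow> 'h" where "soc_gen g = (\<lambda>b. sH (soc_fun g b) g)"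

lemma soc_fun_linear: "Vector_Spaces.linear sA (*) (soc_fun g)"
  unfolding soc_fun_def[abs_def] by (rule linear_compD[OF linear_mult_leftA wfun(1)])

lemma soc_gen_hom_space: "soc_gen g \<in> hom_space"
  unfolding hom_space_def soc_gen_def by (rule CollectI, rule linear_compD[OF soc_fun_linear P.linear_scale_left[OF P.vH]])

lemma soc_gen_one: "P.grouplike g \<Longrightarrow> soc_gen g 1 = g"
  by (simp add: soc_gen_def soc_fun_def wfun(2)[OF coset_part_weights])

lemma hom_act_soc_gen: "P.grouplike g \<Longrightarrow> P.lf f \<Longrightarrow> hom_act f (soc_gen g) = hom_scale (f g) (soc_gen g)"
  by (simp add: hom_act_def soc_gen_def hom_scale_def linear_scaleD[OF P.lact_linear] P.grouplikeD mult.commute)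

lemma soc_gen_nonzero: "P.grouplike g \<Longrightarrow> soc_gen g \<noteq> 0"
  using soc_gen_one P.grouplike_nonzero by force

text \<open>\<open>wvec (coset_part g) * a\<close> has weight \<open>coset_part g * y\<close>, which
  is also \<open>coset_part (g * y)\<close>, and the weight space there is a line.\<close>

lemma hom_mult_soc_gen:
  assumes g: "P.grouplike g" and y: "P.grouplike y" and a: "a \<in> weight_space y"
  obtains c where "hom_mult (soc_gen g) a = hom_scale c (soc_gen (g * y))"
proof (cases "a = 0")
  case True
  then have "hom_mult (soc_gen g) a = hom_scale 0 (soc_gen (g * y))"
    by (simp add: linear_zeroD[OF hom_mult_linear_right[OF soc_gen_hom_space]])
  then show ?thesis by (rule that)
next
  case False
  then have yF: "y \<in> weights" using y a by (auto simp: weights_def)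
  note o = coset_part_weights[OF g]
  have oy: "coset_part g * y \<in> weights" by (rule weights_mult[OF o yF])
  obtain c where c: "wvec (coset_part g) * a = sA c (wvec (coset_part g * y))"
    by (rule weight_space_unique[OF weights_grouplike[OF oy] wvec[OF oy] weight_space_mult[OF wvec(1)[OF o] a]])
  have "hom_mult (soc_gen g) a = (\<lambda>b. sH (soc_fun g (a * b)) g * y)"
    using hom_mult_weight_space[OF soc_gen_hom_space a, of g] by (simp add: soc_gen_def)
  moreover have "soc_fun g (a * b) = c * soc_fun (g * y) b" for b
    by (simp add: soc_fun_def coset_part_mult[OF g yF] mult.assoc[symmetric] c A.scale_mult_left linear_scaleD[OF wfun(1)])
  ultimately have "hom_mult (soc_gen g) a = hom_scale c (soc_gen (g * y))"
    by (simp add: hom_scale_def soc_gen_def P.scale_mult_left)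
  then show ?thesis by (rule that)
qed

section \<open>Maximality and the weights of the quotient\<close>

definition avoiding :: "('a \<Rightarrow> 'h) set \<Rightarrow> bool"
  where "avoiding Z \<longleftrightarrow> hopf_sub Z \<and> (\<forall>g. P.grouplike g \<longrightarrow> soc_gen g \<notin> Z)"

text \<open>Zorn's lemma: avoidance and the closure conditions pass to unions of nonempty chains,
  and \<open>{0}\<close> qualifies because no \<open>soc_gen g\<close> vanishes.\<close>

lemma ex_maximal_avoiding:
  "\<exists>Z. avoiding Z \<and> (\<forall>X. avoiding X \<longrightarrow> Z \<subseteq> X \<longrightarrow> X = Z)"
proof -
  have "avoiding {0}"
    unfolding avoiding_def hopf_sub_def
    using M.V.subspace_0[OF subspace_hom_space] M.stable_zero soc_gen_nonzero
    by (auto simp: linear_zeroD[OF hom_mult_linear_left])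
  moreover have "\<Union>\<C> \<in> Collect avoiding" if ne: "\<C> \<noteq> {}" and ch: "subset.chain (Collect avoiding) \<C>" for \<C>
  proof -
    have av: "avoiding X" if "X \<in> \<C>" for X using ch that unfolding subset.chain_def by blast
    have hs: "hopf_sub X" if "X \<in> \<C>" for X using av[OF that] by (simp add: avoiding_def)
    have "M.V.subspace (\<Union>\<C>)"
    proof (rule M.V.subspaceI)
      show "0 \<in> \<Union>\<C>" using ne M.V.subspace_0[OF hopf_subD(3)[OF hs]] by blast
      fix x y c assume "x \<in> \<Union>\<C>" "y \<in> \<Union>\<C>"
      then obtain X Y where XY: "X \<in> \<C>" "Y \<in> \<C>" "x \<in> X" "y \<in> Y" by blast
      then have "X \<subseteq> Y \<or> Y \<subseteq> X" using ch unfolding subset.chain_def by blast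
      then obtain W where "W \<in> \<C>" "x \<in> W" "y \<in> W" using XY by blast
      then show "x + y \<in> \<Union>\<C>" using M.V.subspace_add[OF hopf_subD(3)[OF hs]] by blast
      show "hom_scale c x \<in> \<Union>\<C>" using XY M.V.subspace_scale[OF hopf_subD(3)[OF hs]] by blast
    qed
    then have "M.stable (\<Union>\<C>)"
      by (rule M.stableI) (use M.stable_act[OF hopf_subD(2)[OF hs]] in blast)
    moreover have "\<Union>\<C> \<subseteq> hom_space" using hopf_subD(1)[OF hs] by blast
    moreover have "hom_mult T a \<in> \<Union>\<C>" if "T \<in> \<Union>\<C>" for T a using hopf_subD(4)[OF hs] that by blast
    ultimately show ?thesis using av by (auto simp: avoiding_def hopf_sub_def)
  qed
  ultimately have "\<exists>Z\<in>Collect avoiding. \<forall>X\<in>Collect avoiding. Z \<subseteq> X \<longrightarrow> X = Z"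
    by (intro subset_Zorn_nonempty) auto
  then show ?thesis by auto
qed

text \<open>The submodule enlarged by \<open>T\<close> must contain some
  \<open>soc_gen g' = z + T a\<close>, and this equation can be solved for \<open>T\<close> because
  \<open>a\<close> is a unit.\<close>

lemma weight_vector_mod_avoiding:
  assumes Z: "avoiding Z" and max: "\<And>X. avoiding X \<Longrightarrow> Z \<subseteq> X \<Longrightarrow> X = Z"
    and T: "T \<in> hom_space" "T \<notin> Z" and g: "P.grouplike g" and w: "M.weight_mod Z g T"
  obtains c where "c \<noteq> 0" "T - hom_scale c (soc_gen g) \<in> Z"
proof -
  have hZ: "hopf_sub Z" using Z by (simp add: avoiding_def)
  note Zs = hopf_subD(3)[OF hZ]
  let ?Y = "{x + y | x y. x \<in> Z \<and> y \<in> range (hom_mult T)}"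
  have "\<not> avoiding ?Y"
    using max[of ?Y] subset_extend[OF hZ T(1)] T(2) by blast
  then obtain g' where g': "P.grouplike g'" "soc_gen g' \<in> ?Y"
    using hopf_sub_extend[OF hZ T(1) w] by (auto simp: avoiding_def)
  then obtain z a where z: "z \<in> Z" and za: "soc_gen g' = z + hom_mult T a" by blast
  have a0: "a \<noteq> 0"
  proof
    assume "a = 0"
    then have "soc_gen g' = z" using za linear_zeroD[OF hom_mult_linear_right[OF T(1)]] by simp
    with z Z g'(1) show False by (auto simp: avoiding_def)
  qed
  let ?x = "antipode g * g'"
  have x: "P.grouplike ?x" by (rule P.grouplike_mult[OF P.grouplike_antipode(3)[OF g] g'(1)])
  have gx: "g * ?x = g'" by (rule grouplike_solve(2)[OF g])
  \<comment> \<open>\<open>T a\<close> has weight \<open>g'\<close> modulo \<open>Z\<close>. As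
    \<open>hom_mult T\<close> is injective modulo \<open>Z\<close> and twists weights by
    \<open>g\<close>, the weight descends to \<open>a\<close>.\<close>
  have aW: "a \<in> weight_space ?x"
    unfolding weight_space_def
  proof (intro CollectI allI impI)
    fix f0 assume "P.lf f0"
    then obtain f where f: "P.lf f" and f0: "f0 = (\<lambda>h. f (g * h))" by (rule lf_shift[OF g])
    have m: "hom_mult T a = soc_gen g' - z" using za by simp
    have "hom_act f (hom_mult T a) - hom_scale (f g') (hom_mult T a) = hom_scale (f g') z - hom_act f z"
      by (simp add: m M.act_diff[OF f] hom_act_soc_gen[OF g'(1) f] M.V.scale_right_diff_distrib)
    then have "hom_act f (hom_mult T a) - hom_scale (f g') (hom_mult T a) \<in> Z"
      using M.V.subspace_diff[OF Zs M.V.subspace_scale[OF Zs z] M.stable_act[OF hopf_subD(2)[OF hZ] f z]] by simp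
    from M.V.subspace_diff[OF Zs this hom_act_hom_mult_weight[OF hZ T(1) w f, of a]]
    have "hom_mult T (cact f0 a) - hom_scale (f g') (hom_mult T a) \<in> Z" by (simp add: f0)
    then have "hom_mult T (cact f0 a - sA (f g') a) \<in> Z"
      by (simp add: linear_diffD[OF hom_mult_linear_right[OF T(1)]] linear_scaleD[OF hom_mult_linear_right[OF T(1)]])
    then have "cact f0 a - sA (f g') a = 0" by (rule hom_mult_mem_imp_zero[OF hZ T g w])
    then show "cact f0 a = sA (f0 ?x) a" by (simp add: f0 gx)
  qed
  obtain b where b: "a * b = 1" "b * a = 1" "b \<in> weight_space (antipode ?x)" by (rule weight_space_unit[OF x aW a0])
  have "(g * ?x) * antipode ?x = g * (?x * antipode ?x)" by (rule mult.assoc)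
  then have xg: "g' * antipode ?x = g" by (simp only: gx P.grouplike_antipode(2)[OF x] mult_1_right)
  \<comment> \<open>Compatibility along the cosets is used here: \<open>g'\<close> and
    \<open>g\<close> differ by the weight of the unit \<open>b\<close>.\<close>
  obtain c where c: "hom_mult (soc_gen g') b = hom_scale c (soc_gen g)"
    by (rule hom_mult_soc_gen[OF g'(1) P.grouplike_antipode(3)[OF x] b(3), unfolded xg])
  have "T = hom_mult (hom_mult T a) b" by (simp add: hom_mult_hom_mult[OF T(1)] b(1) hom_mult_one[OF T(1)])
  also have "\<dots> = hom_scale c (soc_gen g) - hom_mult z b"
    using za by (simp add: c[symmetric] linear_diffD[OF hom_mult_linear_left, symmetric])
  finally have eq: "T - hom_scale c (soc_gen g) = - hom_mult z b" by simp
  have Tc: "T - hom_scale c (soc_gen g) \<in> Z"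
    unfolding eq by (rule M.V.subspace_neg[OF Zs hopf_subD(4)[OF hZ z]])
  moreover have "c \<noteq> 0" using Tc T(2) by auto
  ultimately show ?thesis using that by blast
qed

text \<open>Grouplikes are vectors of distinct weights in \<open>H\<close> under
  \<open>lact\<close>, hence independent; dual functionals exist by prescribing values.\<close>

lemma ex_dual_grouplikes:
  "finite (Collect P.grouplike)"
  "\<exists>e. \<forall>g. P.lf (e g) \<and> (\<forall>g'. P.grouplike g' \<longrightarrow> e g g' = (if g' = g then 1 else 0))"
proof -
  have nz: "g \<notin> {0}" if "g \<in> Collect P.grouplike" for g using P.grouplike_nonzero that by simp
  have w: "D.weight_mod {0} g g" if "g \<in> Collect P.grouplike" for g
    using that by (simp add: D.weight_mod_def P.grouplikeD)
  have "P.independent (Collect P.grouplike)"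
    unfolding P.independent_explicit_finite_subsets
    using D.weights_independent[OF D.stable_zero, of "Collect P.grouplike" "\<lambda>g. g", OF nz w] by simp
  then show "finite (Collect P.grouplike)" by (rule P.finiteI_independent)
  have ex: "\<exists>l. P.lf l \<and> (\<forall>g'. P.grouplike g' \<longrightarrow> l g' = (if g' = g then 1 else 0))" for g
    using D.ex_weight_functional[where c = "\<lambda>g'. if g' = g then 1 else 0" and L = "\<lambda>g. g" and I = "Collect P.grouplike", OF D.stable_zero nz w]
    by auto
  show "\<exists>e. \<forall>g. P.lf (e g) \<and> (\<forall>g'. P.grouplike g' \<longrightarrow> e g g' = (if g' = g then 1 else 0))"
    using ex by (intro choice allI)
qed

text \<open>The map is \<open>h \<mapsto> h_1 e_g(h_2) \<otimes> soc_fun g\<close>, summed over the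
  grouplikes \<open>g\<close>. Right contraction commutes with the left coaction, and on a grouplike
  only its own summand survives.\<close>

lemma ex_comodule_map_to_hom_space:
  obtains t where "Vector_Spaces.linear sH hom_scale t" "\<And>h. t h \<in> hom_space"
    "\<And>f h. P.lf f \<Longrightarrow> hom_act f (t h) = t (P.lact f h)" "\<And>g. P.grouplike g \<Longrightarrow> t g = soc_gen g"
proof -
  let ?G = "Collect P.grouplike"
  obtain e where e: "\<And>g. P.lf (e g)"
    and eg: "\<And>g g'. P.grouplike g' \<Longrightarrow> e g g' = (if g' = g then 1 else 0)"
    using ex_dual_grouplikes(2) by blast
  define t where "t h = (\<lambda>b. \<Sum>g\<in>?G. sH (soc_fun g b) (P.ract (e g) h))" for h
  show ?thesis
  proof
    show "Vector_Spaces.linear sH hom_scale t"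
    proof (rule linearI[OF P.vH vM]; rule ext)
      fix x y c b
      show "t (x + y) b = (t x + t y) b"
        by (simp add: t_def linear_addD[OF P.ract_linear[OF e]] P.scale_right_distrib sum.distrib)
      show "t (sH c x) b = hom_scale c (t x) b"
        by (simp add: t_def hom_scale_def linear_scaleD[OF P.ract_linear[OF e]] P.scale_sum_right mult.commute)
    qed
    show "t h \<in> hom_space" for h
      unfolding hom_space_def t_def
      by (intro CollectI linearI[OF vA P.vH])
         (simp_all add: linear_addD[OF soc_fun_linear] linear_scaleD[OF soc_fun_linear] P.scale_left_distrib
           sum.distrib P.scale_sum_right)
    show "hom_act f (t h) = t (P.lact f h)" if f: "P.lf f" for f h
      by (simp add: hom_act_def t_def linear_sumD[OF P.lact_linear[OF f]] linear_scaleD[OF P.lact_linear[OF f]]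
          P.lact_ract[OF f e])
    show "t g = soc_gen g" if g: "P.grouplike g" for g
    proof
      fix b
      have "t g b = (\<Sum>g'\<in>?G. if g' = g then sH (soc_fun g b) g else 0)"
        unfolding t_def using g by (intro sum.cong) (auto simp: P.ract_grouplike[OF g e] eg)
      also have "\<dots> = soc_gen g b" using ex_dual_grouplikes(1) g by (simp add: soc_gen_def)
      finally show "t g b = soc_gen g b" .
    qed
  qed
qed

text \<open>The quotient of \<open>hom_space\<close> by \<open>Z\<close> is represented by its image
  under one coefficient map \<open>?j\<close>, which has kernel \<open>Z\<close> and fills
  \<open>H\<close>. Adjoining a weight vector to a Hopf submodule above \<open>Z\<close> enlarges
  this image by exactly \<open>dim A\<close>.\<close>

theorem dim_dvd: "A.dim UNIV dvd P.dim UNIV"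
proof -
  obtain BA where BA: "finite_dimensional_vector_space sA BA" using finite_dim_A by blast
  interpret FA: finite_dimensional_vector_space sA BA by fact
  interpret FAH: finite_dimensional_vector_space_pair_1 sA BA sH by unfold_locales
  obtain Z where Z: "avoiding Z" and max: "\<And>X. avoiding X \<Longrightarrow> Z \<subseteq> X \<Longrightarrow> X = Z"
    using ex_maximal_avoiding by blast
  have hZ: "hopf_sub Z" using Z by (simp add: avoiding_def)
  note stZ = hopf_subD(2)[OF hZ]
  obtain l where l: "Vector_Spaces.linear hom_scale (*) l" and lZ: "\<And>z. z \<in> Z \<Longrightarrow> l z = 0"
    and lL: "\<And>g. P.grouplike g \<Longrightarrow> l (soc_gen g) = 1"
  proof -
    have nz: "soc_gen g \<notin> Z" if "g \<in> Collect P.grouplike" for g using Z that by (simp add: avoiding_def)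
    have w: "M.weight_mod Z g (soc_gen g)" if "g \<in> Collect P.grouplike" for g
      using that M.V.subspace_0[OF hopf_subD(3)[OF hZ]] by (simp add: M.weight_mod_def hom_act_soc_gen)
    show ?thesis
      using M.ex_weight_functional[where c = "\<lambda>_. 1" and L = soc_gen and I = "Collect P.grouplike", OF stZ nz w] that by auto
  qed
  let ?j = "M.coef l"
  interpret j: Vector_Spaces.linear hom_scale sH ?j by (rule M.coef_linear[OF l])
  have jZ: "?j z = 0" if "z \<in> Z" for z by (rule M.coef_eq_0[OF l stZ lZ that])
  \<comment> \<open>A larger kernel would contain a weight vector modulo \<open>Z\<close>, which is
    a nonzero multiple of some \<open>soc_gen g\<close> there; but \<open>l\<close> takes the value
    1 on \<open>soc_gen g\<close>.\<close>
  have ker: "T \<in> Z" if T: "T \<in> hom_space" "?j T = 0" for T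
  proof (rule ccontr)
    assume TZ: "T \<notin> Z"
    let ?K = "{T \<in> hom_space. ?j T = 0}"
    have K: "M.stable ?K"
    proof (rule M.stableI)
      show "M.V.subspace ?K"
        using M.V.subspace_inter[OF subspace_hom_space j.subspace_kernel] by (simp add: Int_def)
      fix f T assume f: "P.lf f" and "T \<in> ?K"
      then show "hom_act f T \<in> ?K"
        using M.stable_act[OF stable_hom_space f] M.lact_coef[OF l f, of T]
        by (simp add: linear_zeroD[OF P.lact_linear[OF f]])
    qed
    have "Z \<subset> ?K" using hopf_subD(1)[OF hZ] jZ T TZ by blast
    then obtain v g where v: "v \<in> ?K" "v \<notin> Z" "P.grouplike g" "M.weight_mod Z g v"
      by (rule M.ex_weight_vector[OF stZ K])
    then have "v \<in> hom_space" "?j v = 0" by auto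
    obtain c where c: "c \<noteq> 0" "v - hom_scale c (soc_gen g) \<in> Z"
      by (rule weight_vector_mod_avoiding[OF Z max \<open>v \<in> hom_space\<close> v(2,3,4)])
    have "l v = c" using lZ[OF c(2)] by (simp add: linear_diffD[OF l] linear_scaleD[OF l] lL[OF v(3)])
    moreover have "l v = 0"
      using M.counit_coef[OF l, of v] \<open>?j v = 0\<close> by (simp add: linear_zeroD[OF P.lf_counit])
    ultimately show False using c(1) by simp
  qed
  have surj: "?j ` hom_space = UNIV"
  proof -
    obtain t where t: "Vector_Spaces.linear sH hom_scale t" "\<And>h. t h \<in> hom_space"
      "\<And>f h. P.lf f \<Longrightarrow> hom_act f (t h) = t (P.lact f h)" "\<And>g. P.grouplike g \<Longrightarrow> t g = soc_gen g"
      by (rule ex_comodule_map_to_hom_space) blast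
    \<comment> \<open>A comodule endomorphism of \<open>H\<close>. A nonzero kernel would contain a
      multiple of a grouplike, on whose image the counit is 1; so it is injective, and surjective by
      finite dimension.\<close>
    let ?i = "\<lambda>h. ?j (t h)"
    have lin: "Vector_Spaces.linear sH sH ?i"
      by (rule linear_compD[OF t(1) M.coef_linear[OF l]])
    interpret i: Vector_Spaces.linear sH sH ?i by (rule lin)
    let ?K = "{h. ?i h = 0}"
    have K: "D.stable ?K"
    proof (rule D.stableI)
      show "P.subspace ?K" by (rule i.subspace_kernel)
      fix f h assume f: "P.lf f" and "h \<in> ?K"
      then show "P.lact f h \<in> ?K"
        using M.lact_coef[OF l f, of "t h"] by (simp add: t(3)[OF f] linear_zeroD[OF P.lact_linear[OF f]])
    qed
    have "?K = {0}"
    proof (rule ccontr)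
      assume "?K \<noteq> {0}"
      then have "{0} \<subset> ?K" using i.zero by blast
      then obtain v g where v: "v \<in> ?K" "v \<notin> {0}" "P.grouplike g" "D.weight_mod {0} g v"
        by (rule D.ex_weight_vector[OF D.stable_zero K])
      have vg: "v = sH (counit v) g"
      proof (rule P.lf_eqI)
        fix f assume f: "P.lf f"
        have "f v = counit (P.lact f v)" by (simp add: P.counit_lact[OF f])
        also have "P.lact f v = sH (f g) v" using v(4) f by (simp add: D.weight_mod_def)
        finally show "f v = f (sH (counit v) g)"
          by (simp add: linear_scaleD[OF P.lf_counit] linear_scaleD[OF f])
      qed
      have ig: "counit (?i g) = 1"
        using M.counit_coef[OF l, of "soc_gen g"] by (simp add: t(4)[OF v(3)] lL[OF v(3)])
      have "?i v = sH (counit v) (?i g)" using vg i.scale by metis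
      then have "counit (?i v) = counit v" by (simp only: linear_scaleD[OF P.lf_counit] ig mult_1_right)
      then have "counit v = 0" using v(1) by (simp add: linear_zeroD[OF P.lf_counit])
      then have "v = 0" using vg by simp
      with v(2) show False by simp
    qed
    then have "inj ?i" unfolding i.inj_iff_eq_0 by blast
    then have "surj ?i" by (rule P.linear_inj_imp_surj[OF lin])
    show ?thesis
    proof (intro equalityI subset_UNIV subsetI)
      fix h :: 'h
      obtain h' where "h = ?i h'" using \<open>surj ?i\<close> by (rule surjE)
      then show "h \<in> ?j ` hom_space" using t(2) by blast
    qed
  qed
  \<comment> \<open>The image of \<open>X\<close> under \<open>?j\<close> has the dimension of
    \<open>X / Z\<close>. These dimensions are bounded by that of \<open>H\<close>, so a largest one
    divisible by \<open>dim A\<close> exists.\<close>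
  let ?Q = "\<lambda>X. hopf_sub X \<and> Z \<subseteq> X \<and> A.dim UNIV dvd P.dim (?j ` X)"
  have "?j ` Z = {0}" using jZ M.V.subspace_0[OF hopf_subD(3)[OF hZ]] by force
  then have "?Q Z" using hZ by simp
  moreover have "\<forall>X. ?Q X \<longrightarrow> P.dim (?j ` X) < Suc P.dimension"
    using P.dim_subset_UNIV by (simp add: less_Suc_eq_le)
  ultimately obtain X where X: "?Q X" and maxX: "\<And>Y. ?Q Y \<Longrightarrow> P.dim (?j ` Y) \<le> P.dim (?j ` X)"
    using ex_has_greatest_nat[of ?Q Z "\<lambda>X. P.dim (?j ` X)" "Suc P.dimension"] by (auto simp: less_Suc_eq_le)
  have hX: "hopf_sub X" using X by blast
  note Xs = hopf_subD(3)[OF hX]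
  have "X = hom_space"
  proof (rule ccontr)
    assume "X \<noteq> hom_space"
    then have "X \<subset> hom_space" using hopf_subD(1)[OF hX] by blast
    then obtain T g where T: "T \<in> hom_space" "T \<notin> X" and g: "P.grouplike g" and w: "M.weight_mod X g T"
      by (rule M.ex_weight_vector[OF hopf_subD(2)[OF hX] stable_hom_space])
    let ?Y = "{x + y | x y. x \<in> X \<and> y \<in> range (hom_mult T)}"
    have hY: "hopf_sub ?Y" by (rule hopf_sub_extend[OF hX T(1) w])
    let ?q = "\<lambda>a. ?j (hom_mult T a)"
    have lin: "Vector_Spaces.linear sA sH ?q"
      by (rule linear_compD[OF hom_mult_linear_right[OF T(1)] M.coef_linear[OF l]])
    interpret q: Vector_Spaces.linear sA sH ?q by (rule lin)
    \<comment> \<open>As the kernel \<open>Z\<close> of \<open>?j\<close> lies in \<open>X\<close>,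
      a common value would put \<open>hom_mult T a\<close> into \<open>X\<close>. This yields both
      injectivity of \<open>?q\<close> and directness of the sum.\<close>
    have q0: "a = 0" if a: "?q a \<in> ?j ` X" for a
    proof -
      obtain x where x: "x \<in> X" "?q a = ?j x" using a by blast
      have "?j (hom_mult T a - x) = 0" by (simp add: j.diff x(2))
      moreover have "hom_mult T a - x \<in> hom_space"
        using hom_mult_in[OF T(1)] x(1) hopf_subD(1)[OF hX] by (intro M.V.subspace_diff[OF subspace_hom_space]) auto
      ultimately have "hom_mult T a - x \<in> X" using ker X by blast
      from M.V.subspace_add[OF Xs this x(1)] have "hom_mult T a \<in> X" by simp
      then show ?thesis by (rule hom_mult_mem_imp_zero[OF hX T g w])
    qed
    have jX0: "0 \<in> ?j ` X" using M.V.subspace_0[OF Xs] j.zero by force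
    have "inj ?q" unfolding q.inj_iff_eq_0 using q0 jX0 by metis
    then have dq: "P.dim (range ?q) = A.dim UNIV"
      using FAH.dim_image_eq[OF lin, of UNIV] by simp
    have "?j ` ?Y = {x + y | x y. x \<in> ?j ` X \<and> y \<in> range ?q}"
    proof (intro equalityI subsetI)
      fix h assume "h \<in> ?j ` ?Y"
      then obtain x a where "x \<in> X" "h = ?j (x + hom_mult T a)" by blast
      then show "h \<in> {x + y | x y. x \<in> ?j ` X \<and> y \<in> range ?q}" by (auto simp: j.add)
    next
      fix h assume "h \<in> {x + y | x y. x \<in> ?j ` X \<and> y \<in> range ?q}"
      then obtain x a where x: "x \<in> X" "h = ?j x + ?q a" by blast
      then have "h = ?j (x + hom_mult T a)" by (simp add: j.add)
      with x(1) show "h \<in> ?j ` ?Y" by blast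
    qed
    moreover have "P.subspace (?j ` X)" "P.subspace (range ?q)"
      using j.subspace_image[OF Xs] q.subspace_image[OF A.subspace_UNIV] by simp_all
    moreover have "?j ` X \<inter> range ?q = {0}"
    proof (intro equalityI subsetI)
      fix h assume h: "h \<in> ?j ` X \<inter> range ?q"
      then obtain a where a: "h = ?q a" by blast
      with h have "a = 0" by (intro q0) simp
      then show "h \<in> {0}" using a q.zero by simp
    next
      fix h :: 'h assume "h \<in> {0}"
      then show "h \<in> ?j ` X \<inter> range ?q" using jX0 q.zero rangeI[of ?q 0] by simp
    qed
    ultimately have dY: "P.dim (?j ` ?Y) = P.dim (?j ` X) + A.dim UNIV"
      using P.dim_sums_Int[of "?j ` X" "range ?q"] dq by simp
    have "?Q ?Y" using hY X dY subset_extend(1)[OF hX T(1)] by auto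
    from maxX[OF this] have "A.dim UNIV = 0" unfolding dY by simp
    then have "UNIV \<subseteq> {0 :: 'a}" by (simp only: FA.dim_eq_0)
    then have "(1 :: 'a) \<in> {0}" by (rule subsetD) simp
    then show False by simp
  qed
  with X surj show ?thesis by simp
qed

end

theorem theorem7p3:
  fixes sH :: "'k::field \<Rightarrow> 'h::ring_1 \<Rightarrow> 'h"
    and comult :: "'h \<Rightarrow> ('h \<times> 'h \<Rightarrow>\<^sub>0 'k)"
    and counit :: "'h \<Rightarrow> 'k"
    and antipode :: "'h \<Rightarrow> 'h"
    and sA :: "'k \<Rightarrow> 'a::ring_1 \<Rightarrow> 'a"
    and coact :: "'a \<Rightarrow> ('h \<times> 'a \<Rightarrow>\<^sub>0 'k)"
  assumes "hopf_algebra sH comult counit antipode"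
    and "\<exists>B. finite_dimensional_vector_space sH B"
    and "pointed sH comult"
    and "comodule_algebra sH comult counit antipode sA coact"
    and "right_H_simple sH sA coact"
    and "coinvariants sH sA coact = range (\<lambda>c. sA c 1)"
  shows "(\<exists>B. finite_dimensional_vector_space sA B) \<and>
    vector_space.dim sA UNIV dvd vector_space.dim sH UNIV"
proof -
  obtain B where B: "finite_dimensional_vector_space sH B" using assms(2) by blast
  interpret simple_comodule_algebra sH comult counit antipode B sA coact
    by (intro simple_comodule_algebra.intro pointed_hopf_algebra.intro pointed_hopf_algebra_axioms.intro
        simple_comodule_algebra_axioms.intro assms B)
  show ?thesis using finite_dim_A dim_dvd by blast
qed

end
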